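(* Let $S=Z(h)$ be a strictly semi-stable $(2,2)$-type surface of $\mathbb{P}^1\times\mathbb{P}^2$. Then there exists $f\in G\cdot h$ such that $f$ is a linear combination of monomials of (at least) one of the sets $$M^{\oplus}((0,0),(-1,0,1)),\quad M^{\oplus}((-1,1),(-2,0,2)),\quad M^{\oplus}((-1,1),(-1,0,1)),\quad M^{\oplus}((-2,2),(-1,0,1)),$$ and these are distinct subsets of $M$.
   Context: Work over $\mathbb{C}$. A $(2,2)$-type surface is an effective divisor $S=Z(h)$ of $\mathbb{P}^1\times\mathbb{P}^2$, where $0\neq h\in V=\mathbb{C}[x_0,x_1]_2\otimes\mathbb{C}[y_0,y_1,y_2]_2$. $G=\mathrm{SL}(2,\mathbb{C})\times\mathrm{SL}(3,\mathbb{C})$ acts linearly on $V$ by linear changes of the coordinates. $S=Z(h)$ is semi-stable if $0\notin\overline{G\cdot h}$; stable (properly stable) if $G\cdot h$ is closed in $V$ and the stabilizer of $h$ is finite; strictly semi-stable if semi-stable but not stable. Equivalently (Hilbert–Mumford), $S$ is not semi-stable (resp. not stable) iff for some non-trivial one-parameter subgroup $\lambda$ of $G$ one has $\lim_{t\to0}\lambda(t)\cdot h=0$ (resp. $\lim_{t\to0}\lambda(t)\cdot h$ exists). $M$ is the set of monomials $x_0^{\alpha_0}x_1^{\alpha_1}y_0^{\beta_0}y_1^{\beta_1}y_2^{\beta_2}$ with $\alpha_0+\alpha_1=2$, $\beta_0+\beta_1+\beta_2=2$ (a basis of $V$). For integers with $r_0+r_1=0$, $r_0\le r_1$, $s_0+s_1+s_2=0$,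 $s_0\le s_1\le s_2$, $$M^{\oplus}((r_0,r_1),(s_0,s_1,s_2))=\{x_0^{\alpha_0}x_1^{\alpha_1}y_0^{\beta_0}y_1^{\beta_1}y_2^{\beta_2}\in M\mid r_0\alpha_0+r_1\alpha_1+s_0\beta_0+s_1\beta_1+s_2\beta_2\geq0\}.$$ *)

theory Defs
  imports "HOL-Analysis.Analysis"
begin

text \<open>
  A bihomogeneous form of bidegree (2,2) is identified with the polynomial function that it
  induces on pairs (x, y) of vectors; this loses nothing because the ground field is infinite.
  The library indexes vectors from 1, so \<open>x\<^sub>0, x\<^sub>1\<close> are \<open>x $ 1, x $ 2\<close> and
  \<open>y\<^sub>0, y\<^sub>1, y\<^sub>2\<close> are \<open>y $ 1, y $ 2, y $ 3\<close>.
\<close>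

type_synonym form = "(complex^2) \<times> (complex^3) \<Rightarrow> complex"

text \<open>A monomial is recorded by its exponents \<open>((\<alpha>\<^sub>0, \<alpha>\<^sub>1), (\<beta>\<^sub>0, \<beta>\<^sub>1, \<beta>\<^sub>2))\<close>.\<close>

type_synonym monomial = "(nat \<times> nat) \<times> (nat \<times> nat \<times> nat)"

fun monomial_form :: "monomial \<Rightarrow> form" where
  "monomial_form ((a0, a1), (b0, b1, b2)) (x, y) =
     (x $ 1) ^ a0 * (x $ 2) ^ a1 * (y $ 1) ^ b0 * (y $ 2) ^ b1 * (y $ 3) ^ b2"

definition M :: "monomial set" where
  "M = {((a0, a1), (b0, b1, b2)) | a0 a1 b0 b1 b2. a0 + a1 = 2 \<and> b0 + b1 + b2 = 2}"

fun M_plus :: "int \<times> int \<Rightarrow> int \<times> int \<times> int \<Rightarrow> monomial set" where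
  "M_plus (r0, r1) (s0, s1, s2) =
     {((a0, a1), (b0, b1, b2)) | a0 a1 b0 b1 b2.
        ((a0, a1), (b0, b1, b2)) \<in> M \<and>
        r0 * int a0 + r1 * int a1 + s0 * int b0 + s1 * int b1 + s2 * int b2 \<ge> 0}"

definition linear_combinations :: "monomial set \<Rightarrow> form set" where
  "linear_combinations A = {f. \<exists>c. f = (\<lambda>p. \<Sum>m\<in>A. c m * monomial_form m p)}"

definition V :: "form set" where
  "V = linear_combinations M"

definition G :: "((complex^2^2) \<times> (complex^3^3)) set" where
  "G = {(A, B). det A = 1 \<and> det B = 1}"

text \<open>
  The pair (A, B) substitutes \<open>\<Sum>\<^sub>j A\<^sub>j\<^sub>i x\<^sub>j\<close> for \<open>x\<^sub>i\<close> and \<open>\<Sum>\<^sub>j B\<^sub>j\<^sub>i y\<^sub>j\<close> for \<open>y\<^sub>i\<close>. With the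
  row-vector product this is a left action, in which a pair of diagonal matrices
  with entries \<open>t\<^bsup>r\<^sub>i\<^esup>\<close>, \<open>t\<^bsup>s\<^sub>j\<^esup>\<close> multiplies a monomial by t to the power of its weight.
\<close>

fun act :: "(complex^2^2) \<times> (complex^3^3) \<Rightarrow> form \<Rightarrow> form" where
  "act (A, B) h = (\<lambda>(x, y). h (x v* A, y v* B))"

definition orbit :: "form \<Rightarrow> form set" where
  "orbit h = (\<lambda>g. act g h) ` G"

definition stabilizer :: "form \<Rightarrow> ((complex^2^2) \<times> (complex^3^3)) set" where
  "stabilizer h = {g \<in> G. act g h = h}"

text \<open>
  V carries its usual topology as a finite-dimensional complex vector space, which is the one
  induced by pointwise convergence of functions. For orbits of G the closures in this topology
  and in the Zariski topology of V coincide.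
\<close>

definition semi_stable :: "form \<Rightarrow> bool" where
  "semi_stable h \<longleftrightarrow> (\<lambda>_. 0) \<notin> top_of_set V closure_of orbit h"

definition stable :: "form \<Rightarrow> bool" where
  "stable h \<longleftrightarrow> closedin (top_of_set V) (orbit h) \<and> finite (stabilizer h)"

definition strictly_semi_stable :: "form \<Rightarrow> bool" where
  "strictly_semi_stable h \<longleftrightarrow> semi_stable h \<and> \<not> stable h"

end

theory Submission
  imports Defs "HOL-Complex_Analysis.Cauchy_Integral_Formula"
begin

text \<open>
  The closure and finiteness conditions in the definition of stability are traced back to one
  compactness statement: if, for every C, the elements g of G for which g h has coefficients
  bounded by C form a bounded set, then the orbit is closed and the stabilizer is bounded; a
  bounded stabilizer is finite, since otherwise its Lie algebra contains some X with
  \<open>X \<noteq> 0\<close>, and \<open>t \<mapsto> exp (t X)\<close> is a nonconstant bounded entire function. Hence a form that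
  is not stable has an unbounded sequence \<open>g\<^sub>n\<close> in G with \<open>g\<^sub>n h\<close> bounded. Gaussian elimination with
  complete pivoting factors \<open>g\<^sub>n\<close> as K D L with K and L in compact sets and D diagonal. A limit of
  the matrices L gives coordinates, and a limit of the normalized logarithms of the diagonals
  gives (up to sign) real weights (r, s), such that every monomial of negative weight has
  coefficient zero. For sorted weights, the monomials of nonnegative weight lie in the first three of
  the given sets, after a further change of coordinates in two cases: \<open>s = 0\<close>, where one moves a
  point of the conic that is the coefficient of \<open>x\<^sub>0 x\<^sub>1\<close> and its tangent line into standard
  position, and weights such as \<open>((-1, 1), (-4, 2, 2))\<close>, where one moves a root of a binary
  quadratic form in \<open>y\<^sub>1, y\<^sub>2\<close>.
\<close>

section \<open>Polarization of forms of bidegree (2,2)\<close>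

text \<open>The full polarization: a second difference in each of the two variables. For a quadratic
  form such a difference is twice the symmetric bilinear form, whence the division by 4. Being built
  from finitely many values of \<open>f\<close>, it is continuous in \<open>f\<close> for pointwise
  convergence.\<close>

definition polar :: "form \<Rightarrow> complex^2 \<Rightarrow> complex^2 \<Rightarrow> complex^3 \<Rightarrow> complex^3 \<Rightarrow> complex" where
  "polar f x x' y y' =
     ((f (x + x', y + y') - f (x, y + y') - f (x', y + y'))
      - (f (x + x', y) - f (x, y) - f (x', y))
      - (f (x + x', y') - f (x, y') - f (x', y'))) / 4"

definition tensor_form ::
    "(2 \<Rightarrow> 2 \<Rightarrow> 3 \<Rightarrow> 3 \<Rightarrow> complex) \<Rightarrow> complex^2 \<Rightarrow> complex^2 \<Rightarrow> complex^3 \<Rightarrow> complex^3 \<Rightarrow> complex" where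
  "tensor_form c x x' y y' =
     (\<Sum>i\<in>UNIV. \<Sum>j\<in>UNIV. \<Sum>k\<in>UNIV. \<Sum>l\<in>UNIV. c i j k l * x $ i * x' $ j * y $ k * y' $ l)"

text \<open>The exponents of \<open>x $ i * x $ j * y $ k * y $ l\<close>; this matches coefficient
  arrays of quadrilinear forms with monomials.\<close>

definition index_monomial :: "2 \<Rightarrow> 2 \<Rightarrow> 3 \<Rightarrow> 3 \<Rightarrow> monomial" where
  "index_monomial i j k l =
     ((of_bool (i = 1) + of_bool (j = 1), of_bool (i = 2) + of_bool (j = 2)),
      (of_bool (k = 1) + of_bool (l = 1), of_bool (k = 2) + of_bool (l = 2), of_bool (k = 3) + of_bool (l = 3)))"

lemma M_eq: "M = {(2,0),(1,1),(0,2)} \<times> {(2,0,0),(1,1,0),(1,0,1),(0,2,0),(0,1,1),(0,0,2)}"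
proof -
  have "(a, b) \<in> {(2,0),(1,1),(0,2)}" if "a + b = 2" for a b :: nat
  proof -
    have "a \<in> {0,1,2}" using that by auto
    thus ?thesis using that by auto
  qed
  moreover have "(a, b, c) \<in> {(2,0,0),(1,1,0),(1,0,1),(0,2,0),(0,1,1),(0,0,2)}"
    if "a + b + c = 2" for a b c :: nat
  proof -
    have "a = 0 \<or> a = 1 \<or> a = 2" "b = 0 \<or> b = 1 \<or> b = 2" "c = 2 - a - b"
      using that by arith+
    thus ?thesis using that by (elim disjE) simp_all
  qed
  ultimately have "m \<in> {(2,0),(1,1),(0,2)} \<times> {(2,0,0),(1,1,0),(1,0,1),(0,2,0),(0,1,1),(0,0,2)}"
    if "m \<in> M" for m
    using that unfolding M_def by (elim CollectE exE conjE) (simp only: mem_Sigma_iff)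
  moreover have "{(2,0),(1,1),(0,2)} \<times> {(2,0,0),(1,1,0),(1,0,1),(0,2,0),(0,1,1),(0,0,2)} \<subseteq> M"
    unfolding M_def by auto
  ultimately show ?thesis
    by (rule equalityI[OF subsetI])
qed

lemma finite_M: "finite M"
  by (simp add: M_eq)

lemma index_monomial_in_M: "index_monomial i j k l \<in> M"
  using exhaust_2[of i] exhaust_2[of j] exhaust_3[of k] exhaust_3[of l]
  by (auto simp: M_def index_monomial_def)

lemma monomial_form_index_monomial:
  "monomial_form (index_monomial i j k l) (x, y) = x $ i * x $ j * y $ k * y $ l"
  using exhaust_2[of i] exhaust_2[of j] exhaust_3[of k] exhaust_3[of l]
  by (auto simp: index_monomial_def power2_eq_square)

lemma V_tensor_form:
  assumes "h \<in> V"
  obtains c where "\<And>i j k l. c j i k l = c i j k l" "\<And>i j k l. c i j l k = c i j k l"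
    "\<And>x y. h (x, y) = tensor_form c x x y y"
proof -
  obtain w where w: "h = (\<lambda>p. \<Sum>m\<in>M. w m * monomial_form m p)"
    using assms by (auto simp: V_def linear_combinations_def)
  \<comment> \<open>The coefficient of a monomial is spread evenly over the index tuples that yield
    it: (i, j) has two orders if i and j differ and one otherwise, and likewise (k, l).
    \<open>d\<close> is 4 times the resulting array, which avoids fractions in the
    expansion.\<close>
  define d where "d i j k l = (if i = j then 2 else 1) * (if k = l then 2 else 1) * w (index_monomial i j k l)"
    for i j k l
  define c where "c i j k l = d i j k l / 4" for i j k l
  have "c j i k l = c i j k l" "c i j l k = c i j k l" for i j k l
    by (auto simp: c_def d_def index_monomial_def add.commute)
  moreover have "h (x, y) = tensor_form c x x y y" for x y
  proof -
    have "4 * h (x, y) = tensor_form d x x y y"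
      unfolding w M_eq tensor_form_def sum.cartesian_product[symmetric] d_def index_monomial_def
        numeral_2_eq_2
      by (simp add: sum_2 sum_3 algebra_simps)
    also have "\<dots> = 4 * tensor_form c x x y y"
      by (simp add: tensor_form_def c_def sum_distrib_left)
    finally show ?thesis by simp
  qed
  ultimately show ?thesis
    by (rule that)
qed

lemma tensor_form_add:
  "tensor_form c (u + v) x' y y' = tensor_form c u x' y y' + tensor_form c v x' y y'"
  "tensor_form c x (u + v) y y' = tensor_form c x u y y' + tensor_form c x v y y'"
  "tensor_form c x x' (s + t) y' = tensor_form c x x' s y' + tensor_form c x x' t y'"
  "tensor_form c x x' y (s + t) = tensor_form c x x' y s + tensor_form c x x' y t"
  by (simp_all add: tensor_form_def algebra_simps sum.distrib)

lemma tensor_form_scale: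
  "tensor_form c (a *s x) x' y y' = a * tensor_form c x x' y y'"
  "tensor_form c x (a *s x') y y' = a * tensor_form c x x' y y'"
  "tensor_form c x x' (a *s y) y' = a * tensor_form c x x' y y'"
  "tensor_form c x x' y (a *s y') = a * tensor_form c x x' y y'"
  by (simp_all add: tensor_form_def sum_distrib_left mult.assoc mult.left_commute)

lemma tensor_form_sym:
  assumes "\<And>i j k l. c j i k l = c i j k l" "\<And>i j k l. c i j l k = c i j k l"
  shows "tensor_form c x' x y y' = tensor_form c x x' y y'"
    and "tensor_form c x x' y' y = tensor_form c x x' y y'"
proof -
  show "tensor_form c x' x y y' = tensor_form c x x' y y'"
    unfolding tensor_form_def
    by (subst sum.swap, intro sum.cong refl) (simp add: assms(1) mult.assoc mult.left_commute)
  show "tensor_form c x x' y' y = tensor_form c x x' y y'"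
    unfolding tensor_form_def
    by (rule sum.cong[OF refl], rule sum.cong[OF refl], subst sum.swap, intro sum.cong refl)
      (simp add: assms(2) mult.assoc mult.left_commute)
qed

lemma polar_eq_tensor_form:
  assumes "h \<in> V"
  obtains c where "polar h = tensor_form c"
    "\<And>i j k l. c j i k l = c i j k l" "\<And>i j k l. c i j l k = c i j k l"
    "\<And>x y. h (x, y) = tensor_form c x x y y"
proof -
  obtain c where c: "\<And>i j k l. c j i k l = c i j k l" "\<And>i j k l. c i j l k = c i j k l"
    "\<And>x y. h (x, y) = tensor_form c x x y y"
    using V_tensor_form[OF assms] by metis
  have "polar h x x' y y' = tensor_form c x x' y y'" for x x' y y'
  proof -
    note sym = tensor_form_sym[of c, OF c(1,2)]
    show ?thesis
      by (simp add: polar_def c(3) tensor_form_add sym(1)[of x' x] sym(2)[of _ _ y' y])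
  qed
  hence "polar h = tensor_form c" by (intro ext)
  thus ?thesis using c that by blast
qed

lemma polar_add:
  assumes "h \<in> V"
  shows "polar h (u + v) x' y y' = polar h u x' y y' + polar h v x' y y'"
    "polar h x (u + v) y y' = polar h x u y y' + polar h x v y y'"
    "polar h x x' (s + t) y' = polar h x x' s y' + polar h x x' t y'"
    "polar h x x' y (s + t) = polar h x x' y s + polar h x x' y t"
proof -
  obtain c where c: "polar h = tensor_form c"
    using polar_eq_tensor_form[OF assms] by metis
  show "polar h (u + v) x' y y' = polar h u x' y y' + polar h v x' y y'"
    "polar h x (u + v) y y' = polar h x u y y' + polar h x v y y'"
    "polar h x x' (s + t) y' = polar h x x' s y' + polar h x x' t y'"
    "polar h x x' y (s + t) = polar h x x' y s + polar h x x' y t"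
    by (simp_all add: c tensor_form_add)
qed

lemma polar_scale:
  assumes "h \<in> V"
  shows "polar h (a *s x) x' y y' = a * polar h x x' y y'"
    "polar h x (a *s x') y y' = a * polar h x x' y y'"
    "polar h x x' (a *s y) y' = a * polar h x x' y y'"
    "polar h x x' y (a *s y') = a * polar h x x' y y'"
proof -
  obtain c where c: "polar h = tensor_form c"
    using polar_eq_tensor_form[OF assms] by metis
  show "polar h (a *s x) x' y y' = a * polar h x x' y y'"
    "polar h x (a *s x') y y' = a * polar h x x' y y'"
    "polar h x x' (a *s y) y' = a * polar h x x' y y'"
    "polar h x x' y (a *s y') = a * polar h x x' y y'"
    by (simp_all add: c tensor_form_scale)
qed

lemma polar_sym:
  assumes "h \<in> V"
  shows "polar h x' x y y' = polar h x x' y y'" "polar h x x' y' y = polar h x x' y y'"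
proof -
  obtain c where c: "polar h = tensor_form c"
    "\<And>i j k l. c j i k l = c i j k l" "\<And>i j k l. c i j l k = c i j k l"
    using polar_eq_tensor_form[OF assms] by metis
  show "polar h x' x y y' = polar h x x' y y'" "polar h x x' y' y = polar h x x' y y'"
    using tensor_form_sym[of c, OF c(2,3)] by (simp_all add: c(1))
qed

lemma polar_diag:
  assumes "h \<in> V"
  shows "polar h x x y y = h (x, y)"
  using polar_eq_tensor_form[OF assms] by metis

lemma tensor_form_sum:
  "tensor_form c (sum u S) x' y y' = (\<Sum>i\<in>S. tensor_form c (u i) x' y y')"
  "tensor_form c x (sum u S) y y' = (\<Sum>i\<in>S. tensor_form c x (u i) y y')"
  "tensor_form c x x' (sum w S') y' = (\<Sum>i\<in>S'. tensor_form c x x' (w i) y')"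
  "tensor_form c x x' y (sum w S') = (\<Sum>i\<in>S'. tensor_form c x x' y (w i))"
proof -
  have zero: "tensor_form c 0 x' y y' = 0" "tensor_form c x 0 y y' = 0"
    "tensor_form c x x' 0 y' = 0" "tensor_form c x x' y 0 = 0" for x x' y y'
    by (simp_all add: tensor_form_def)
  show "tensor_form c (sum u S) x' y y' = (\<Sum>i\<in>S. tensor_form c (u i) x' y y')"
    by (induction S rule: infinite_finite_induct) (simp_all add: tensor_form_add zero)
  show "tensor_form c x (sum u S) y y' = (\<Sum>i\<in>S. tensor_form c x (u i) y y')"
    by (induction S rule: infinite_finite_induct) (simp_all add: tensor_form_add zero)
  show "tensor_form c x x' (sum w S') y' = (\<Sum>i\<in>S'. tensor_form c x x' (w i) y')"
    by (induction S' rule: infinite_finite_induct) (simp_all add: tensor_form_add zero)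
  show "tensor_form c x x' y (sum w S') = (\<Sum>i\<in>S'. tensor_form c x x' y (w i))"
    by (induction S' rule: infinite_finite_induct) (simp_all add: tensor_form_add zero)
qed

lemma vector_matrix_mult_rows: "x v* A = (\<Sum>i\<in>UNIV. x $ i *s A $ i)"
  for A :: "'a::comm_semiring_1^'m^'n"
  by (simp add: vector_matrix_mult_def vec_eq_iff mult.commute)

text \<open>Since \<open>x v* A\<close> is the combination of the rows of \<open>A\<close> with
  coefficients \<open>x $ i\<close>, the coefficients of a transformed form are values of
  \<open>polar h\<close> on rows. From here on the rows of \<open>A\<close> and \<open>B\<close>
  play the part of new coordinate vectors.\<close>

lemma polar_vector_matrix_mult:
  assumes "h \<in> V"
  shows "polar h (x v* A) (x' v* A) (y v* B) (y' v* B) =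
    tensor_form (\<lambda>i j k l. polar h (A $ i) (A $ j) (B $ k) (B $ l)) x x' y y'"
proof -
  obtain c where c: "polar h = tensor_form c"
    using polar_eq_tensor_form[OF assms] by metis
  show ?thesis
    unfolding vector_matrix_mult_rows c
      tensor_form_def[of "\<lambda>i j k l. tensor_form c (A $ i) (A $ j) (B $ k) (B $ l)"]
    by (simp only: tensor_form_sum(1) tensor_form_scale(1), simp only: tensor_form_sum(2) tensor_form_scale(2),
        simp only: tensor_form_sum(3) tensor_form_scale(3), simp only: tensor_form_sum(4) tensor_form_scale(4))
      (simp add: sum_distrib_left ac_simps)
qed

lemma polar_act: "polar (act (A, B) h) x x' y y' = polar h (x v* A) (x' v* A) (y v* B) (y' v* B)"
  by (simp add: polar_def vector_matrix_left_distrib)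

lemma axis_vector_matrix_mult: "axis i 1 v* A = A $ i"
  for A :: "'a::comm_semiring_1^'m^'n"
  by (simp add: vector_matrix_mult_def vec_eq_iff axis_def if_distrib[of "\<lambda>c. c * _"]
    if_distrib[of "\<lambda>c. _ * c"] cong: if_cong)

lemma linear_combinationsI:
  assumes "A \<subseteq> M"
    and "\<And>i j k l. index_monomial i j k l \<notin> A \<Longrightarrow> c i j k l = 0"
    and f: "\<And>x y. f (x, y) = tensor_form c x x y y"
  shows "f \<in> linear_combinations A"
proof -
  define m where "m = (\<lambda>(i, j, k, l). index_monomial i j k l)"
  define d where "d = (\<lambda>(i, j, k, l). c i j k l)"
  \<comment> \<open>Several index tuples give the same monomial, so its coefficient is the sum of
    \<open>d\<close> over the fibre of \<open>m\<close>.\<close>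
  define w where "w n = (\<Sum>t\<in>{t. m t = n}. d t)" for n
  have "f p = (\<Sum>n\<in>A. w n * monomial_form n p)" for p
  proof -
    obtain x y where p: "p = (x, y)" by force
    have "f p = (\<Sum>t\<in>UNIV. d t * monomial_form (m t) p)"
      by (simp add: p f tensor_form_def sum.cartesian_product d_def m_def case_prod_beta
        monomial_form_index_monomial mult.assoc)
    also have "\<dots> = (\<Sum>n\<in>M. \<Sum>t\<in>{t\<in>UNIV. m t = n}. d t * monomial_form (m t) p)"
      by (rule sum.group[symmetric]) (auto simp: finite_M m_def index_monomial_in_M)
    also have "\<dots> = (\<Sum>n\<in>M. w n * monomial_form n p)"
      by (simp add: w_def sum_distrib_right)
    also have "\<dots> = (\<Sum>n\<in>A. w n * monomial_form n p)"
    proof (rule sum.mono_neutral_right)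
      have "w n = 0" if "n \<notin> A" for n
        unfolding w_def using that assms(2) by (intro sum.neutral) (auto simp: m_def d_def)
      thus "\<forall>n\<in>M - A. w n * monomial_form n p = 0" by simp
    qed (use assms(1) finite_M in auto)
    finally show ?thesis .
  qed
  thus ?thesis
    unfolding linear_combinations_def by blast
qed

section \<open>The orbit map and closedness of the orbit\<close>

lemma act_tensor_form:
  assumes "h \<in> V"
  shows "act (A, B) h (x, y) = tensor_form (\<lambda>i j k l. polar h (A $ i) (A $ j) (B $ k) (B $ l)) x x y y"
  using polar_vector_matrix_mult[OF assms] by (simp add: polar_diag[OF assms, symmetric])

lemma act_in_V:
  assumes "h \<in> V"
  shows "act g h \<in> V"
proof (cases g)
  case (Pair A B)
  show ?thesis
    unfolding V_def Pair
    by (rule linear_combinationsI[OF _ _ act_tensor_form[OF assms]]) (simp_all add: index_monomial_in_M)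
qed

lemma orbit_subset_V: "h \<in> V \<Longrightarrow> orbit h \<subseteq> V"
  unfolding orbit_def using act_in_V by blast

lemma continuous_on_polar [continuous_intros]:
  assumes "h \<in> V" "continuous_on S f" "continuous_on S f'" "continuous_on S g" "continuous_on S g'"
  shows "continuous_on S (\<lambda>z. polar h (f z) (f' z) (g z) (g' z))"
proof -
  obtain c where c: "polar h = tensor_form c"
    using polar_eq_tensor_form[OF assms(1)] by metis
  show ?thesis
    unfolding c tensor_form_def by (intro continuous_intros assms)
qed

lemma tendsto_polar [tendsto_intros]:
  assumes "h \<in> V" "(f \<longlongrightarrow> x) F" "(f' \<longlongrightarrow> x') F" "(g \<longlongrightarrow> y) F" "(g' \<longlongrightarrow> y') F"
  shows "((\<lambda>z. polar h (f z) (f' z) (g z) (g' z)) \<longlongrightarrow> polar h x x' y y') F"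
proof -
  obtain c where c: "polar h = tensor_form c"
    using polar_eq_tensor_form[OF assms(1)] by metis
  show ?thesis
    unfolding c tensor_form_def by (intro tendsto_intros assms)
qed

text \<open>The preimage in G of a bounded set of coefficients under the orbit map of
  \<open>h\<close>. If it is bounded for every \<open>C\<close>, the orbit map is proper.\<close>

definition bounded_elements :: "form \<Rightarrow> real \<Rightarrow> ((complex^2^2) \<times> (complex^3^3)) set" where
  "bounded_elements h C =
     {(A, B) \<in> G. \<forall>i j k l. cmod (polar h (A $ i) (A $ j) (B $ k) (B $ l)) \<le> C}"

lemma continuous_on_det [continuous_intros]:
  fixes f :: "'a::topological_space \<Rightarrow> complex^'n^'n"
  assumes "continuous_on S f"
  shows "continuous_on S (\<lambda>z. det (f z))"
  unfolding det_def by (intro continuous_intros assms)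

lemma closed_bounded_elements:
  assumes "h \<in> V"
  shows "closed (bounded_elements h C)"
proof -
  have "bounded_elements h C = {g. det (fst g) = 1} \<inter> {g. det (snd g) = 1} \<inter>
    (\<Inter>i j k l. {g. cmod (polar h (fst g $ i) (fst g $ j) (snd g $ k) (snd g $ l)) \<le> C})"
    by (auto simp: bounded_elements_def G_def)
  also have "closed \<dots>"
    by (intro closed_Int closed_INT ballI closed_Collect_eq closed_Collect_le continuous_intros assms)
  finally show ?thesis .
qed

lemma continuous_on_act:
  assumes "h \<in> V"
  shows "continuous_on S (\<lambda>g. act g h)"
proof (rule continuous_on_coordinatewise_then_product)
  fix p :: "(complex^2) \<times> (complex^3)"
  obtain x y where p: "p = (x, y)" by force
  have *: "act g h p = polar h (x v* fst g) (x v* fst g) (y v* snd g) (y v* snd g)" for g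
    by (cases g) (simp add: p polar_diag[OF assms])
  show "continuous_on S (\<lambda>g. act g h p)"
    unfolding * vector_matrix_mult_def by (intro continuous_intros assms)
qed

lemma Hausdorff_form: "Hausdorff_space (euclidean :: form topology)"
  unfolding euclidean_product_topology[symmetric] by (simp add: Hausdorff_space_product_topology)

text \<open>A proper map has closed image: near a form \<open>v\<close> in the closure, the orbit
  lies in the image of the compact set \<open>bounded_elements h C\<close>. This image is closed, so
  it contains \<open>v\<close>.\<close>

lemma closedin_orbit:
  assumes "h \<in> V" and bdd: "\<And>C. bounded (bounded_elements h C)"
  shows "closedin (top_of_set V) (orbit h)"
proof -
  have "v \<in> orbit h" if v: "v \<in> closure (orbit h)" for v
  proof -
    \<comment> \<open>Adding 1 makes the inequalities at \<open>v\<close> strict, so that the open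
      set \<open>U\<close> below is a neighbourhood of \<open>v\<close>.\<close>
    define C where "C = Max (range (\<lambda>(i, j, k, l).
      cmod (polar v (axis i 1) (axis j 1) (axis k 1) (axis l 1)))) + 1"
    have C: "cmod (polar v (axis i 1) (axis j 1) (axis k 1) (axis l 1)) < C" for i j k l
    proof -
      have "cmod (polar v (axis i 1) (axis j 1) (axis k 1) (axis l 1)) \<le> Max (range (\<lambda>(i, j, k, l).
        cmod (polar v (axis i 1) (axis j 1) (axis k 1) (axis l 1))))"
        by (rule Max_ge) (auto intro!: image_eqI[of _ _ "(i, j, k, l)"])
      thus ?thesis by (simp add: C_def)
    qed
    define U where "U = (\<Inter>i j k l. {f. cmod (polar f (axis i 1) (axis j 1) (axis k 1) (axis l 1)) < C})"
    have "open U"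
      unfolding U_def polar_def
      by (intro open_INT ballI finite open_Collect_less continuous_intros continuous_on_product_coordinates) simp_all
    have "orbit h \<inter> U \<subseteq> (\<lambda>g. act g h) ` bounded_elements h C"
    proof
      fix f assume f: "f \<in> orbit h \<inter> U"
      then obtain A B where g: "(A, B) \<in> G" "f = act (A, B) h"
        by (auto simp: orbit_def)
      have "cmod (polar h (A $ i) (A $ j) (B $ k) (B $ l)) < C" for i j k l
        using f by (simp add: U_def g(2) polar_act axis_vector_matrix_mult del: act.simps)
      thus "f \<in> (\<lambda>g. act g h) ` bounded_elements h C"
        using g by (auto simp: bounded_elements_def less_imp_le simp del: act.simps)
    qed
    have "compact (bounded_elements h C)"
      using closed_bounded_elements[OF assms(1)] bdd by (simp add: compact_eq_bounded_closed)
    hence "compact ((\<lambda>g. act g h) ` bounded_elements h C)"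
      by (intro compact_continuous_image continuous_on_act assms(1))
    hence closed: "closed ((\<lambda>g. act g h) ` bounded_elements h C)"
      using compactin_imp_closedin[OF Hausdorff_form] by simp
    have "v \<in> U \<inter> closure (orbit h)"
      using v C by (auto simp: U_def)
    also have "\<dots> \<subseteq> closure (U \<inter> orbit h)"
      by (rule open_Int_closure_subset) fact
    also have "\<dots> \<subseteq> (\<lambda>g. act g h) ` bounded_elements h C"
      using \<open>orbit h \<inter> U \<subseteq> _\<close> closed by (intro closure_minimal) auto
    also have "\<dots> \<subseteq> orbit h"
      by (auto simp: orbit_def bounded_elements_def)
    finally show ?thesis .
  qed
  hence "closed (orbit h)"
    using closure_subset_eq by blast
  thus ?thesis
    using orbit_subset_V[OF assms(1)] by (rule closed_subset[rotated])
qed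

section \<open>Pivoting in the special linear group\<close>

text \<open>An elementary matrix: from the left it adds \<open>c $ i\<close> times row s to row i,
  and its transpose does the same to columns from the right.\<close>

definition transvection :: "complex^'n \<Rightarrow> 'n \<Rightarrow> complex^'n^'n" where
  "transvection c s = (\<chi> i j. (if i = j then 1 else 0) + (if j = s then c $ i else 0))"

definition swap_matrix :: "'n \<Rightarrow> 'n \<Rightarrow> complex^'n^'n" where
  "swap_matrix p s = (\<chi> i j. if j = Transposition.transpose p s i then 1 else 0)"

definition entries_le :: "real \<Rightarrow> complex^'n^'m \<Rightarrow> bool" where
  "entries_le b A \<longleftrightarrow> (\<forall>i j. cmod (A $ i $ j) \<le> b)"

lemma transvection_mult: "(transvection c s ** A) $ i $ j = A $ i $ j + c $ i * A $ s $ j"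
  by (simp add: transvection_def matrix_matrix_mult_def distrib_right sum.distrib
      if_distrib[of "\<lambda>z. z * _"] cong: if_cong)

lemma mult_transpose_transvection:
  "(A ** transpose (transvection c s)) $ i $ j = A $ i $ j + A $ i $ s * c $ j"
  by (simp add: transvection_def transpose_def matrix_matrix_mult_def distrib_left sum.distrib
      if_distrib[of "\<lambda>z. _ * z"] cong: if_cong)

lemma transvection_inverse:
  assumes "c $ s = 0"
  shows "transvection c s ** transvection (- c) s = mat 1"
  using assms by (simp add: vec_eq_iff transvection_mult) (simp add: transvection_def mat_def)

text \<open>The transpose is the identity matrix with a combination of the other rows added to row
  s.\<close>

lemma det_transvection:
  fixes s :: "'n::finite"
  assumes "c $ s = 0"
  shows "det (transvection c s) = 1"
proof -
  let ?I = "mat 1 :: complex^'n^'n"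
  define x where "x = (\<Sum>j\<in>-{s}. c $ j *s row j ?I)"
  have "x \<in> vec.span {row j ?I | j. j \<noteq> s}"
    unfolding x_def by (intro vec.span_sum vec.span_scale vec.span_base) auto
  hence "det (\<chi> k. if k = s then row s ?I + x else row k ?I) = det ?I"
    by (rule det_row_span)
  also have "(\<chi> k. if k = s then row s ?I + x else row k ?I) = transpose (transvection c s)"
  proof -
    have "x $ j = c $ j" for j
    proof -
      have "x $ j = (\<Sum>i\<in>-{s}. if i = j then c $ i else 0)"
        by (simp add: x_def row_def mat_def if_distrib[of "\<lambda>z. _ * z"] cong: if_cong)
      thus ?thesis using assms by (auto simp: sum.delta')
    qed
    thus ?thesis
      by (simp add: vec_eq_iff transpose_def transvection_def row_def mat_def eq_commute)
  qed
  finally show ?thesis by simp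
qed

lemma entries_le_transvection:
  assumes "c $ s = 0" "\<And>i. cmod (c $ i) \<le> 1"
  shows "entries_le 1 (transvection c s)"
  using assms by (auto simp: entries_le_def transvection_def)

lemma swap_matrix_mult: "(swap_matrix p s ** A) $ i = A $ Transposition.transpose p s i"
  by (simp add: swap_matrix_def matrix_matrix_mult_def vec_eq_iff
      if_distrib[of "\<lambda>z. z * _"] cong: if_cong)

lemma mult_swap_matrix: "(A ** swap_matrix p s) $ i $ j = A $ i $ Transposition.transpose p s j"
proof -
  have "j = Transposition.transpose p s k \<longleftrightarrow> k = Transposition.transpose p s j" for k
    by (metis transpose_involutory)
  thus ?thesis
    by (simp add: swap_matrix_def matrix_matrix_mult_def
        if_distrib[of "\<lambda>z. _ * z"] cong: if_cong)
qed

lemma swap_matrix_inverse: "swap_matrix p s ** swap_matrix p s = mat 1"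
  by (simp add: vec_eq_iff swap_matrix_mult) (simp add: swap_matrix_def mat_def)

text \<open>A swap may have determinant -1, so the factorizations below control determinants only in
  modulus.\<close>

lemma cmod_det_swap_matrix: "cmod (det (swap_matrix p s :: complex^'n::finite^'n)) = 1"
proof -
  let ?t = "Transposition.transpose p s"
  have "(swap_matrix p s :: complex^'n::finite^'n) = (\<chi> i. mat 1 $ ?t i)"
    by (auto simp: vec_eq_iff swap_matrix_def mat_def)
  moreover have "?t permutes UNIV" by (rule permutes_swap_id) auto
  ultimately show ?thesis
    by (simp add: det_permute_rows sign_def)
qed

lemma entries_le_swap_matrix: "entries_le 1 (swap_matrix p s)"
  by (simp add: entries_le_def swap_matrix_def)

lemma entries_le_mult:
  fixes A :: "complex^'n::finite^'m" and B :: "complex^'k^'n"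
  assumes "entries_le a A" "entries_le b B" "0 \<le> a"
  shows "entries_le (real CARD('n) * (a * b)) (A ** B)"
  unfolding entries_le_def
proof (intro allI)
  fix i j
  have "cmod ((A ** B) $ i $ j) \<le> (\<Sum>k\<in>UNIV. cmod (A $ i $ k * B $ k $ j))"
    unfolding matrix_matrix_mult_def by (simp add: norm_sum)
  also have "\<dots> \<le> (\<Sum>k\<in>(UNIV::'n set). a * b)"
    using assms by (intro sum_mono) (auto simp: norm_mult entries_le_def intro!: mult_mono)
  finally show "cmod ((A ** B) $ i $ j) \<le> real CARD('n) * (a * b)" by simp
qed

lemma entries_le_transpose: "entries_le b A \<Longrightarrow> entries_le b (transpose A)"
  by (simp add: entries_le_def transpose_def)

text \<open>Gaussian elimination with complete pivoting: all multipliers are at most 1 in modulus.\<close>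

lemma pivoting_on:
  fixes S :: "'n::finite set"
  shows "\<exists>b>0. \<forall>g::complex^'n^'n. \<exists>K K' L D. g = K' ** D ** L \<and> K ** K' = mat 1 \<and>
    entries_le b K \<and> entries_le b K' \<and> entries_le b L \<and> cmod (det K) = 1 \<and> cmod (det L) = 1 \<and>
    (\<forall>i j. i \<noteq> j \<and> (i \<in> S \<or> j \<in> S) \<longrightarrow> D $ i $ j = 0)"
  using finite[of S]
proof (induction S rule: finite_induct)
  case empty
  have "entries_le 1 (mat 1 :: complex^'n^'n)" by (simp add: entries_le_def mat_def)
  show ?case
  proof (rule exI[of _ 1], intro conjI allI)
    fix g :: "complex^'n^'n"
    show "\<exists>K K' L D. g = K' ** D ** L \<and> K ** K' = mat 1 \<and>
      entries_le 1 K \<and> entries_le 1 K' \<and> entries_le 1 L \<and> cmod (det K) = 1 \<and> cmod (det L) = 1 \<and>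
      (\<forall>i j. i \<noteq> j \<and> (i \<in> {} \<or> j \<in> {}) \<longrightarrow> D $ i $ j = 0)"
      by (rule exI[of _ "mat 1"], rule exI[of _ "mat 1"], rule exI[of _ "mat 1"], rule exI[of _ g])
        (simp add: \<open>entries_le 1 _\<close>)
  qed simp
next
  case (insert s S)
  then obtain b where "b > 0" and b: "\<And>g::complex^'n^'n. \<exists>K K' L D. g = K' ** D ** L \<and> K ** K' = mat 1 \<and>
    entries_le b K \<and> entries_le b K' \<and> entries_le b L \<and> cmod (det K) = 1 \<and> cmod (det L) = 1 \<and>
    (\<forall>i j. i \<noteq> j \<and> (i \<in> S \<or> j \<in> S) \<longrightarrow> D $ i $ j = 0)" by metis
  let ?n = "real CARD('n)"
  \<comment> \<open>Each of K, K' and L gains two factors with entries at most 1, and each such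
    product costs a factor \<open>?n\<close>.\<close>
  let ?b = "?n * (?n * b)"
  show ?case
  proof (rule exI[of _ ?b], intro conjI allI)
    show "?b > 0" using \<open>b > 0\<close> by simp
    fix g :: "complex^'n^'n"
    obtain K K' L D where g: "g = K' ** D ** L" "K ** K' = mat 1"
      "entries_le b K" "entries_le b K'" "entries_le b L" "cmod (det K) = 1" "cmod (det L) = 1"
      and D: "\<And>i j. i \<noteq> j \<and> (i \<in> S \<or> j \<in> S) \<Longrightarrow> D $ i $ j = 0"
      using b[of g] by metis
    define N where "N = (\<lambda>(i, j). cmod (D $ i $ j))"
    \<comment> \<open>The pivot is an entry of largest modulus in the block that is not yet cleared;
      this block is nonempty because it contains position (s, s).\<close>
    obtain p q where pq: "p \<notin> S" "q \<notin> S" "\<And>i j. i \<notin> S \<Longrightarrow> j \<notin> S \<Longrightarrow> cmod (D $ i $ j) \<le> cmod (D $ p $ q)"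
    proof -
      have "Max (N ` ((-S) \<times> (-S))) \<in> N ` ((-S) \<times> (-S))"
        using insert.hyps by (intro Max_in) auto
      then obtain p q where "p \<notin> S" "q \<notin> S" and m: "Max (N ` ((-S) \<times> (-S))) = cmod (D $ p $ q)"
        by (auto simp: N_def)
      moreover have "cmod (D $ i $ j) \<le> cmod (D $ p $ q)" if "i \<notin> S" "j \<notin> S" for i j
        unfolding m[symmetric] using that by (intro Max_ge) (auto simp: N_def intro!: image_eqI[of _ _ "(i, j)"])
      ultimately show ?thesis using that by blast
    qed
    \<comment> \<open>The two swaps carry the pivot to position (s, s) and leave the indices in
      \<open>S\<close> alone.\<close>
    define P where "P = (swap_matrix p s :: complex^'n^'n)"
    define Q where "Q = (swap_matrix q s :: complex^'n^'n)"
    define D1 where "D1 = P ** D ** Q"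
    have D1: "D1 $ i $ j = D $ Transposition.transpose p s i $ Transposition.transpose q s j" for i j
      by (simp add: D1_def mult_swap_matrix P_def Q_def swap_matrix_mult)
    have fixed: "Transposition.transpose p s i = i" "Transposition.transpose q s i = i" if "i \<in> S" for i
      using that pq insert.hyps by (auto simp: Transposition.transpose_def)
    have unfixed: "Transposition.transpose p s i \<notin> S" "Transposition.transpose q s i \<notin> S" if "i \<notin> S" for i
      using that pq insert.hyps by (auto simp: Transposition.transpose_def)
    have D1_zero: "D1 $ i $ j = 0" if ij: "i \<noteq> j" "i \<in> S \<or> j \<in> S" for i j
      unfolding D1
    proof (rule D)
      consider "i \<in> S" "j \<in> S" | "i \<in> S" "j \<notin> S" | "i \<notin> S" "j \<in> S" using ij(2) by blast
      thus "Transposition.transpose p s i \<noteq> Transposition.transpose q s j \<and>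
        (Transposition.transpose p s i \<in> S \<or> Transposition.transpose q s j \<in> S)"
      proof cases
        case 1 thus ?thesis using ij fixed by simp
      next
        case 2 thus ?thesis using fixed(1)[of i] unfixed(2)[of j] by auto
      next
        case 3 thus ?thesis using unfixed(1)[of i] fixed(2)[of j] by auto
      qed
    qed
    have D1_max: "cmod (D1 $ i $ j) \<le> cmod (D1 $ s $ s)" if "i \<notin> S" "j \<notin> S" for i j
      unfolding D1 using pq(3)[OF unfixed(1)[OF that(1)] unfixed(2)[OF that(2)]] by simp
    have D1_row: "cmod (D1 $ i $ s) \<le> cmod (D1 $ s $ s)" "cmod (D1 $ s $ i) \<le> cmod (D1 $ s $ s)" for i
    proof -
      consider "i = s" | "i \<noteq> s" "i \<in> S" | "i \<notin> S" by blast
      hence "cmod (D1 $ i $ s) \<le> cmod (D1 $ s $ s) \<and> cmod (D1 $ s $ i) \<le> cmod (D1 $ s $ s)"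
        using D1_max[of i s] D1_max[of s i] D1_zero[of i s] D1_zero[of s i] insert.hyps(2) by cases auto
      thus "cmod (D1 $ i $ s) \<le> cmod (D1 $ s $ s)" "cmod (D1 $ s $ i) \<le> cmod (D1 $ s $ s)"
        by auto
    qed
    \<comment> \<open>The elimination multipliers are at most 1 in modulus because the pivot
      dominates its row and column. If the pivot is 0, then its row and column vanish, and division
      by 0 yields the multiplier 0, which is the right value.\<close>
    define c where "c = (\<chi> i. if i = s then 0 else D1 $ i $ s / D1 $ s $ s)"
    define d where "d = (\<chi> j. if j = s then 0 else D1 $ s $ j / D1 $ s $ s)"
    have cs: "c $ s = 0" "d $ s = 0" "cmod (c $ i) \<le> 1" "cmod (d $ i) \<le> 1" for i
      using D1_row[of i] by (auto simp: c_def d_def norm_divide divide_le_eq)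
    \<comment> \<open>\<open>E\<close> clears column s from the left and \<open>F\<close> clears row
      s from the right; \<open>E'\<close> and \<open>F'\<close> are their inverses.\<close>
    define E where "E = transvection (- c) s"
    define E' where "E' = transvection c s"
    define F where "F = transpose (transvection (- d) s)"
    define F' where "F' = transpose (transvection d s)"
    have EE: "E ** E' = mat 1" "E' ** E = mat 1" 
      using transvection_inverse[of "- c" s] transvection_inverse[of c s] cs by (simp_all add: E_def E'_def)
    have FF: "F ** F' = mat 1"
      using transvection_inverse[of d s] cs by (simp add: F_def F'_def flip: matrix_transpose_mul)
    have PP: "P ** P = mat 1" "Q ** Q = mat 1" by (simp_all add: P_def Q_def swap_matrix_inverse)
    define D2 where "D2 = E ** D1 ** F"
    have "D = P ** E' ** D2 ** (F' ** Q)"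
    proof -
      have "P ** E' ** D2 ** (F' ** Q) = P ** (E' ** E) ** P ** D ** Q ** (F ** F') ** Q"
        by (simp add: D2_def D1_def matrix_mul_assoc)
      also have "\<dots> = P ** P ** D ** (Q ** Q)"
        unfolding EE FF by (simp add: matrix_mul_assoc)
      finally show ?thesis by (simp add: PP)
    qed
    hence "g = (K' ** (P ** E')) ** D2 ** ((F' ** Q) ** L)"
      by (simp add: g(1) matrix_mul_assoc)
    moreover have "(E ** (P ** K)) ** (K' ** (P ** E')) = mat 1"
    proof -
      have "(E ** (P ** K)) ** (K' ** (P ** E')) = E ** (P ** (K ** K') ** P) ** E'"
        by (simp add: matrix_mul_assoc)
      thus ?thesis by (simp add: g(2) PP EE)
    qed
    moreover have ent: "entries_le 1 E" "entries_le 1 E'" "entries_le 1 F'" "entries_le 1 P" "entries_le 1 Q"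
      using cs by (auto simp: E_def E'_def F'_def P_def Q_def
          intro!: entries_le_transpose entries_le_transvection entries_le_swap_matrix)
    have "entries_le ?b (E ** (P ** K))"
      using entries_le_mult[OF ent(1) entries_le_mult[OF ent(4) g(3)]] by simp
    moreover have "entries_le ?b (K' ** (P ** E'))"
      using entries_le_mult[OF g(4) entries_le_mult[OF ent(4,2)]] \<open>b > 0\<close> by (simp add: ac_simps)
    moreover have "entries_le ?b ((F' ** Q) ** L)"
      using entries_le_mult[OF ent(3) entries_le_mult[OF ent(5) g(5)]] by (simp add: matrix_mul_assoc)
    moreover have "cmod (det (E ** (P ** K))) = 1" "cmod (det ((F' ** Q) ** L)) = 1"
      using cs by (simp_all add: det_mul norm_mult g P_def Q_def cmod_det_swap_matrix E_def F'_def det_transvection)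
    moreover have "D2 $ i $ j = 0" if ij: "i \<noteq> j" "i \<in> insert s S \<or> j \<in> insert s S" for i j
    proof -
      have D2: "D2 $ i $ j = D1 $ i $ j - c $ i * D1 $ s $ j - (D1 $ i $ s - c $ i * D1 $ s $ s) * d $ j"
        for i j
        by (simp add: D2_def E_def F_def mult_transpose_transvection transvection_mult)
      have c: "c $ i * D1 $ s $ s = D1 $ i $ s" if "i \<noteq> s" for i
        using that D1_row[of i] by (auto simp: c_def)
      have d: "D1 $ s $ s * d $ j = D1 $ s $ j" if "j \<noteq> s" for j
        using that D1_row[of j] by (auto simp: d_def)
      consider "i = s" | "j = s" | "i \<noteq> s" "j \<noteq> s" "i \<in> S \<or> j \<in> S" using ij by blast
      thus ?thesis
      proof cases
        case 1 thus ?thesis using ij d[of j] cs by (simp add: D2)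
      next
        case 2 thus ?thesis using ij c[of i] cs by (simp add: D2)
      next
        case 3
        \<comment> \<open>Elimination does not refill cleared entries: for i in \<open>S\<close> the
          multiplier \<open>c $ i\<close> is 0, and for j in \<open>S\<close> the entry
          \<open>D1 $ s $ j\<close> is 0.\<close>
        have "c $ i * D1 $ s $ j = 0"
          using 3 D1_zero[of i s] D1_zero[of s j] by (auto simp: c_def)
        thus ?thesis using 3 D1_zero[OF ij(1)] c[of i] by (simp add: D2)
      qed
    qed
    ultimately show "\<exists>K K' L D. g = K' ** D ** L \<and> K ** K' = mat 1 \<and>
      entries_le ?b K \<and> entries_le ?b K' \<and> entries_le ?b L \<and> cmod (det K) = 1 \<and> cmod (det L) = 1 \<and>
      (\<forall>i j. i \<noteq> j \<and> (i \<in> insert s S \<or> j \<in> insert s S) \<longrightarrow> D $ i $ j = 0)"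
      by blast
  qed
qed

definition diagonal_matrix :: "complex^'n \<Rightarrow> complex^'n^'n" where
  "diagonal_matrix d = (\<chi> i j. if i = j then d $ i else 0)"

lemma pivoting:
  obtains b where "b > 0"
    "\<And>g::complex^'n::finite^'n. \<exists>K K' L d. g = K' ** (diagonal_matrix d ** L) \<and> K ** g = diagonal_matrix d ** L \<and>
    entries_le b K \<and> entries_le b K' \<and> entries_le b L \<and> cmod (det K) = 1 \<and> cmod (det L) = 1"
proof -
  obtain b where "b > 0" and b: "\<And>g::complex^'n^'n. \<exists>K K' L D. g = K' ** D ** L \<and> K ** K' = mat 1 \<and>
    entries_le b K \<and> entries_le b K' \<and> entries_le b L \<and> cmod (det K) = 1 \<and> cmod (det L) = 1 \<and>
    (\<forall>i j. i \<noteq> j \<and> (i \<in> UNIV \<or> j \<in> UNIV) \<longrightarrow> D $ i $ j = 0)"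
    using pivoting_on[of "UNIV :: 'n set"] by metis
  have "\<exists>K K' L d. g = K' ** (diagonal_matrix d ** L) \<and> K ** g = diagonal_matrix d ** L \<and>
    entries_le b K \<and> entries_le b K' \<and> entries_le b L \<and> cmod (det K) = 1 \<and> cmod (det L) = 1"
    for g :: "complex^'n^'n"
  proof -
    obtain K K' L D where g: "g = K' ** D ** L" "K ** K' = mat 1"
      "entries_le b K" "entries_le b K'" "entries_le b L" "cmod (det K) = 1" "cmod (det L) = 1"
      and D: "\<And>i j. i \<noteq> j \<Longrightarrow> D $ i $ j = 0"
      using b[of g] by auto
    have "D = diagonal_matrix (\<chi> i. D $ i $ i)"
      using D by (auto simp: diagonal_matrix_def vec_eq_iff)
    moreover have "g = K' ** (D ** L)" "K ** g = D ** L"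
      by (simp_all add: g(1) matrix_mul_assoc g(2))
    ultimately show ?thesis
      using g(3-) by (intro exI[of _ K] exI[of _ K'] exI[of _ L] exI[of _ "\<chi> i. D $ i $ i"]) simp
  qed
  with \<open>b > 0\<close> show ?thesis by (rule that)
qed

section \<open>From bounded factors to limiting weights\<close>

lemma norm_le_entries:
  fixes A :: "complex^'n::finite^'m::finite"
  assumes "entries_le b A"
  shows "norm A \<le> real CARD('m) * (real CARD('n) * b)"
proof -
  have "norm A \<le> (\<Sum>i\<in>UNIV. norm (A $ i))"
    unfolding norm_vec_def[of A] by (rule L2_set_le_sum) simp
  also have "\<dots> \<le> (\<Sum>i\<in>(UNIV::'m set). real CARD('n) * b)"
  proof (rule sum_mono)
    fix i
    have "norm (A $ i) \<le> (\<Sum>j\<in>UNIV. cmod (A $ i $ j))"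
      unfolding norm_vec_def[of "A $ i"] by (rule L2_set_le_sum) simp
    also have "\<dots> \<le> (\<Sum>j\<in>(UNIV::'n set). b)"
      using assms by (intro sum_mono) (simp add: entries_le_def)
    finally show "norm (A $ i) \<le> real CARD('n) * b" by simp
  qed
  finally show ?thesis by simp
qed

lemma matrix_mult_row: "(K ** A) $ i = K $ i v* A"
  for K :: "'a::comm_semiring_1^'m^'n"
  by (simp add: matrix_matrix_mult_def vector_matrix_mult_def vec_eq_iff mult.commute)

lemma diagonal_matrix_mult_row: "(diagonal_matrix d ** A) $ i = d $ i *s A $ i"
  by (simp add: diagonal_matrix_def matrix_matrix_mult_def vec_eq_iff
      if_distrib[of "\<lambda>z. z * _"] cong: if_cong)

lemma det_diagonal_matrix: "det (diagonal_matrix d) = (\<Prod>i\<in>UNIV. d $ i)"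
  by (subst det_diagonal) (simp_all add: diagonal_matrix_def)

text \<open>Pivoting in the form needed for limits: \<open>u\<close> holds the logarithms of the
  moduli of the diagonal, and its sum is 0 because all determinants have modulus 1. The bound on the
  inverse of \<open>K\<close> gives the estimate of \<open>norm g\<close>, so an unbounded
  \<open>g\<close> forces an unbounded \<open>u\<close>.\<close>

lemma special_linear_factorization:
  obtains b c where "b > 0" "c > 0"
    "\<And>g::complex^'n::finite^'n. det g = 1 \<Longrightarrow> \<exists>K L z (u::real^'n). entries_le b K \<and> entries_le b L \<and>
      cmod (det L) = 1 \<and> (\<Sum>i\<in>UNIV. u $ i) = 0 \<and> norm g \<le> c * exp (norm u) \<and>
      (\<forall>i. cmod (z i) = exp (u $ i) \<and> K $ i v* g = z i *s L $ i)"
proof -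
  obtain b where "b > 0" and b: "\<And>g::complex^'n^'n. \<exists>K K' L d. g = K' ** (diagonal_matrix d ** L) \<and>
    K ** g = diagonal_matrix d ** L \<and>
    entries_le b K \<and> entries_le b K' \<and> entries_le b L \<and> cmod (det K) = 1 \<and> cmod (det L) = 1"
    by (fact pivoting)
  define N where "N = real CARD('n)"
  have "N > 0" by (simp add: N_def)
  have "\<exists>K L z (u::real^'n). entries_le b K \<and> entries_le b L \<and>
      cmod (det L) = 1 \<and> (\<Sum>i\<in>UNIV. u $ i) = 0 \<and> norm g \<le> (N * (N * (N * (b * b)))) * exp (norm u) \<and>
      (\<forall>i. cmod (z i) = exp (u $ i) \<and> K $ i v* g = z i *s L $ i)"
    if "det g = 1" for g :: "complex^'n^'n"
  proof -
    obtain K K' L d where g: "g = K' ** (diagonal_matrix d ** L)" "K ** g = diagonal_matrix d ** L"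
      "entries_le b K" "entries_le b K'" "entries_le b L" "cmod (det K) = 1" "cmod (det L) = 1"
      using b[of g] by blast
    have "cmod (det (K ** g)) = 1" using that g(6) by (simp add: det_mul)
    hence prod: "(\<Prod>i\<in>UNIV. cmod (d $ i)) = 1"
      using g(7) unfolding g(2) by (simp add: det_mul norm_mult det_diagonal_matrix prod_norm)
    have nz: "d $ i \<noteq> 0" for i
    proof
      assume "d $ i = 0"
      hence "(\<Prod>i\<in>UNIV. cmod (d $ i)) = 0" by (intro prod_zero) auto
      thus False using prod by simp
    qed
    define u :: "real^'n" where "u = (\<chi> i. ln (cmod (d $ i)))"
    have u: "cmod (d $ i) = exp (u $ i)" for i using nz by (simp add: u_def)
    have "exp (\<Sum>i\<in>UNIV. u $ i) = 1" using prod by (simp add: exp_sum u)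
    hence "(\<Sum>i\<in>UNIV. u $ i) = 0" by simp
    moreover have "norm g \<le> (N * (N * (N * (b * b)))) * exp (norm u)"
    proof -
      have "entries_le (exp (norm u) * b) (diagonal_matrix d ** L)"
        unfolding entries_le_def diagonal_matrix_mult_row
      proof (intro allI)
        fix i j
        have "u $ i \<le> norm u" using component_le_norm_cart[of u i] by simp
        thus "cmod ((d $ i *s L $ i) $ j) \<le> exp (norm u) * b"
          using g(5) by (auto simp: norm_mult u entries_le_def intro!: mult_mono)
      qed
      from norm_le_entries[OF entries_le_mult[OF g(4) this]] \<open>b > 0\<close> show ?thesis
        by (simp add: g(1)[symmetric] N_def mult_ac)
    qed
    moreover have "K $ i v* g = d $ i *s L $ i" for i
      using g(2) by (metis matrix_mult_row diagonal_matrix_mult_row)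
    ultimately show ?thesis using g u
      by (intro exI[of _ K] exI[of _ L] exI[of _ "\<lambda>i. d $ i"] exI[of _ u]) simp
  qed
  moreover have "N * (N * (N * (b * b))) > 0" using \<open>N > 0\<close> \<open>b > 0\<close> by simp
  ultimately show ?thesis using \<open>b > 0\<close> that by blast
qed

text \<open>The sum has 2 * 2 * 3 * 3 = 36 terms.\<close>

lemma cmod_tensor_form_le:
  assumes "\<And>i j k l. cmod (c i j k l) \<le> C" "\<And>i. cmod (x $ i) \<le> b" "\<And>i. cmod (x' $ i) \<le> b"
    "\<And>k. cmod (y $ k) \<le> b'" "\<And>k. cmod (y' $ k) \<le> b'"
  shows "cmod (tensor_form c x x' y y') \<le> 36 * (C * b * b * b' * b')"
proof -
  have nn: "0 \<le> C" "0 \<le> b" "0 \<le> b'" using assms norm_ge_zero order_trans by metis+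
  have "cmod (tensor_form c x x' y y') \<le>
      (\<Sum>i\<in>(UNIV::2 set). \<Sum>j\<in>(UNIV::2 set). \<Sum>k\<in>(UNIV::3 set). \<Sum>l\<in>(UNIV::3 set). C * b * b * b' * b')"
    unfolding tensor_form_def
    by (intro sum_norm_le) (auto simp: norm_mult intro!: mult_mono assms mult_nonneg_nonneg nn)
  also have "\<dots> = 36 * (C * b * b * b' * b')" by simp
  finally show ?thesis .
qed

text \<open>In the rows of the factors L, each coefficient times the exponential of its weight stays
  bounded. After the weights are scaled to unit length, a coefficient whose limiting weight is
  positive must tend to 0.\<close>

lemma unbounded_imp_weights:
  assumes "h \<in> V" and unb: "\<not> bounded (bounded_elements h C)"
  obtains A B and r :: "real^2" and s :: "real^3"
  where "det A \<noteq> 0" "det B \<noteq> 0" "(\<Sum>i\<in>UNIV. r $ i) = 0" "(\<Sum>k\<in>UNIV. s $ k) = 0" "(r, s) \<noteq> 0"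
    "\<And>i j k l. r $ i + r $ j + s $ k + s $ l < 0 \<Longrightarrow> polar h (A $ i) (A $ j) (B $ k) (B $ l) = 0"
proof -
  obtain b1 c1 where "b1 > 0" "c1 > 0" and
    fact1: "\<And>g::complex^2^2. det g = 1 \<Longrightarrow> \<exists>K L z (u::real^2). entries_le b1 K \<and> entries_le b1 L \<and>
      cmod (det L) = 1 \<and> (\<Sum>i\<in>UNIV. u $ i) = 0 \<and> norm g \<le> c1 * exp (norm u) \<and>
      (\<forall>i. cmod (z i) = exp (u $ i) \<and> K $ i v* g = z i *s L $ i)"
    using special_linear_factorization[where ?'n=2] by metis
  obtain b2 c2 where "b2 > 0" "c2 > 0" and
    fact2: "\<And>g::complex^3^3. det g = 1 \<Longrightarrow> \<exists>K L z (u::real^3). entries_le b2 K \<and> entries_le b2 L \<and>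
      cmod (det L) = 1 \<and> (\<Sum>i\<in>UNIV. u $ i) = 0 \<and> norm g \<le> c2 * exp (norm u) \<and>
      (\<forall>i. cmod (z i) = exp (u $ i) \<and> K $ i v* g = z i *s L $ i)"
    using special_linear_factorization[where ?'n=3] by metis
  define C' where "C' = 36 * (C * b1 * b1 * b2 * b2)"
  define good where "good n L1 L2 u1 u2 \<longleftrightarrow> entries_le b1 L1 \<and> entries_le b2 L2 \<and>
      cmod (det L1) = 1 \<and> cmod (det L2) = 1 \<and> (\<Sum>i\<in>UNIV. u1 $ i) = 0 \<and> (\<Sum>i\<in>UNIV. u2 $ i) = 0 \<and>
      real n < norm (u1, u2) \<and>
      (\<forall>i j k l. exp (u1 $ i + u1 $ j + u2 $ k + u2 $ l) *
        cmod (polar h (L1 $ i) (L1 $ j) (L2 $ k) (L2 $ l)) \<le> C')"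
    for n :: nat and L1 :: "complex^2^2" and L2 :: "complex^3^3" and u1 :: "real^2" and u2 :: "real^3"
  have "\<exists>L1 L2 u1 u2. good n L1 L2 u1 u2" for n
  proof -
    \<comment> \<open>The threshold is chosen to force \<open>norm (u1, u2)\<close> above
      \<open>n\<close> through the norm estimates of the two factorizations.\<close>
    obtain g where g: "g \<in> bounded_elements h C" "norm g > (c1 + c2) * exp n"
      using unb unfolding bounded_iff by (meson not_le)
    obtain A B where AB: "g = (A, B)" by force
    have dets: "det A = 1" "det B = 1"
      and le: "\<And>i j k l. cmod (polar h (A $ i) (A $ j) (B $ k) (B $ l)) \<le> C"
      using g(1) by (auto simp: AB bounded_elements_def G_def)
    obtain K1 L1 z1 and u1 :: "real^2" where f1: "entries_le b1 K1" "entries_le b1 L1"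
      "cmod (det L1) = 1" "(\<Sum>i\<in>UNIV. u1 $ i) = 0" "norm A \<le> c1 * exp (norm u1)"
      "\<And>i. cmod (z1 i) = exp (u1 $ i)" "\<And>i. K1 $ i v* A = z1 i *s L1 $ i"
      using fact1[OF dets(1)] by metis
    obtain K2 L2 z2 and u2 :: "real^3" where f2: "entries_le b2 K2" "entries_le b2 L2"
      "cmod (det L2) = 1" "(\<Sum>i\<in>UNIV. u2 $ i) = 0" "norm B \<le> c2 * exp (norm u2)"
      "\<And>i. cmod (z2 i) = exp (u2 $ i)" "\<And>i. K2 $ i v* B = z2 i *s L2 $ i"
      using fact2[OF dets(2)] by metis
    have "norm g \<le> norm A + norm B" by (simp add: AB norm_Pair_le)
    also have "\<dots> \<le> c1 * exp (norm (u1, u2)) + c2 * exp (norm (u1, u2))"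
      using norm_fst_le[of u1 u2] norm_snd_le[of u2 u1] \<open>c1 > 0\<close> \<open>c2 > 0\<close>
      by (intro add_mono order.trans[OF f1(5)] order.trans[OF f2(5)] mult_left_mono) auto
    finally have "(c1 + c2) * exp n < (c1 + c2) * exp (norm (u1, u2))"
      using g(2) by (simp add: distrib_right)
    hence "real n < norm (u1, u2)" using \<open>c1 > 0\<close> \<open>c2 > 0\<close> by simp
    moreover have "exp (u1 $ i + u1 $ j + u2 $ k + u2 $ l) *
        cmod (polar h (L1 $ i) (L1 $ j) (L2 $ k) (L2 $ l)) \<le> C'" for i j k l
    proof -
      \<comment> \<open>The factors \<open>z1\<close>, \<open>z2\<close> are absorbed into the rows
        of \<open>L1\<close>, \<open>L2\<close>. This turns the product into a value of
        \<open>polar h\<close> on combinations of rows of \<open>A\<close> and \<open>B\<close> with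
        bounded coefficients.\<close>
      have "exp (u1 $ i + u1 $ j + u2 $ k + u2 $ l) * cmod (polar h (L1 $ i) (L1 $ j) (L2 $ k) (L2 $ l)) =
        cmod (polar h (K1 $ i v* A) (K1 $ j v* A) (K2 $ k v* B) (K2 $ l v* B))"
        by (simp add: f1 f2 polar_scale[OF assms(1)] norm_mult exp_add mult_ac)
      also have "\<dots> \<le> C'"
        unfolding polar_vector_matrix_mult[OF assms(1)] C'_def
        using f1(1) f2(1) le by (intro cmod_tensor_form_le) (auto simp: entries_le_def)
      finally show ?thesis .
    qed
    ultimately show ?thesis
      using f1 f2 unfolding good_def by metis
  qed
  then obtain L1 L2 u1 u2 where good: "\<And>n. good n (L1 n) (L2 n) (u1 n) (u2 n)" by metis
  define w where "w n = (u1 n, u2 n)" for n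
  have wn: "norm (w n) > real n" for n using good[of n] by (simp add: good_def w_def)
  hence wpos: "norm (w n) > 0" for n by (meson of_nat_0_le_iff order.strict_trans1)
  \<comment> \<open>Both matrices and the normalized weights range over bounded sets, so one
    subsequence makes all of them converge. The determinants keep modulus 1 and the weights keep
    norm 1 in the limit.\<close>
  define T where "T n = (L1 n, L2 n, w n /\<^sub>R norm (w n))" for n
  have "bounded (range T)"
  proof -
    have "T n \<in> cball 0 (2 * (2 * b1)) \<times> cball 0 (3 * (3 * b2)) \<times> cball 0 1" for n
      using norm_le_entries[of b1 "L1 n"] norm_le_entries[of b2 "L2 n"] good[of n] wpos[of n]
      by (simp add: T_def good_def)
    hence "range T \<subseteq> cball 0 (2 * (2 * b1)) \<times> cball 0 (3 * (3 * b2)) \<times> cball 0 1" by blast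
    thus ?thesis by (rule bounded_subset[rotated]) (intro bounded_Times bounded_cball)
  qed
  then obtain t \<rho> where \<rho>: "strict_mono \<rho>" "(T \<circ> \<rho>) \<longlonglongrightarrow> t"
    using bounded_imp_convergent_subsequence by blast
  obtain A B r s where t: "t = (A, B, r, s)" by (metis surj_pair)
  have lim: "(\<lambda>n. L1 (\<rho> n)) \<longlonglongrightarrow> A" "(\<lambda>n. L2 (\<rho> n)) \<longlonglongrightarrow> B"
    and limw: "(\<lambda>n. w (\<rho> n) /\<^sub>R norm (w (\<rho> n))) \<longlonglongrightarrow> (r, s)"
    using tendsto_fst[OF \<rho>(2)] tendsto_fst[OF tendsto_snd[OF \<rho>(2)]] tendsto_snd[OF tendsto_snd[OF \<rho>(2)]]
    by (simp_all add: t T_def o_def)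
  have limr: "(\<lambda>n. u1 (\<rho> n) /\<^sub>R norm (w (\<rho> n))) \<longlonglongrightarrow> r" and lims: "(\<lambda>n. u2 (\<rho> n) /\<^sub>R norm (w (\<rho> n))) \<longlonglongrightarrow> s"
    using tendsto_fst[OF limw] tendsto_snd[OF limw] by (simp_all add: w_def)
  have "(\<lambda>n. cmod (det (L1 (\<rho> n)))) \<longlonglongrightarrow> cmod (det A)" "(\<lambda>n. cmod (det (L2 (\<rho> n)))) \<longlonglongrightarrow> cmod (det B)"
    unfolding det_def by (intro tendsto_intros lim)+
  hence "cmod (det A) = 1" "cmod (det B) = 1"
    using good by (simp_all add: good_def LIMSEQ_const_iff)
  hence dets: "det A \<noteq> 0" "det B \<noteq> 0" by auto
  have "(\<lambda>n. \<Sum>i\<in>UNIV. (u1 (\<rho> n) /\<^sub>R norm (w (\<rho> n))) $ i) \<longlonglongrightarrow> (\<Sum>i\<in>UNIV. r $ i)"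
    "(\<lambda>n. \<Sum>i\<in>UNIV. (u2 (\<rho> n) /\<^sub>R norm (w (\<rho> n))) $ i) \<longlonglongrightarrow> (\<Sum>i\<in>UNIV. s $ i)"
    by (intro tendsto_intros limr lims)+
  moreover have "(\<Sum>i\<in>UNIV. (u1 n /\<^sub>R norm (w n)) $ i) = 0" "(\<Sum>i\<in>UNIV. (u2 n /\<^sub>R norm (w n)) $ i) = 0" for n
    using good[of n] by (simp_all add: good_def flip: sum_distrib_left)
  ultimately have sums: "(\<Sum>i\<in>UNIV. r $ i) = 0" "(\<Sum>i\<in>UNIV. s $ i) = 0"
    by (simp_all add: LIMSEQ_const_iff)
  have "(\<lambda>n. norm (w (\<rho> n) /\<^sub>R norm (w (\<rho> n)))) \<longlonglongrightarrow> norm (r, s)"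
    by (intro tendsto_norm limw)
  moreover have "norm (w n /\<^sub>R norm (w n)) = 1" for n using wpos[of n] by simp
  ultimately have "norm (r, s) = 1" by (simp add: LIMSEQ_const_iff)
  hence "(r, s) \<noteq> 0" by auto
  \<comment> \<open>The argument kills coefficients of positive weight for (r, s), while the
    conclusion speaks of negative weight; hence the change of sign.\<close>
  hence nz: "(- r, - s) \<noteq> 0" by (simp add: zero_prod_def)
  have "polar h (A $ i) (A $ j) (B $ k) (B $ l) = 0" if neg: "(- r) $ i + (- r) $ j + (- s) $ k + (- s) $ l < 0"
    for i j k l
  proof -
    define \<sigma> where "\<sigma> = r $ i + r $ j + s $ k + s $ l"
    define \<sigma>n where "\<sigma>n n = (u1 n /\<^sub>R norm (w n)) $ i + (u1 n /\<^sub>R norm (w n)) $ j +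
      (u2 n /\<^sub>R norm (w n)) $ k + (u2 n /\<^sub>R norm (w n)) $ l" for n
    define p where "p n = polar h (L1 n $ i) (L1 n $ j) (L2 n $ k) (L2 n $ l)" for n
    have "\<sigma> > 0" using neg by (simp add: \<sigma>_def)
    have "(\<lambda>n. \<sigma>n (\<rho> n)) \<longlonglongrightarrow> \<sigma>"
      unfolding \<sigma>n_def \<sigma>_def by (intro tendsto_intros limr lims)
    hence ev: "\<forall>\<^sub>F n in sequentially. \<sigma>n (\<rho> n) > \<sigma> / 2"
      using \<open>\<sigma> > 0\<close> by (intro order_tendstoD) auto
    \<comment> \<open>Undoing the normalization brings back the factor \<open>norm (w n)\<close>.
      Along the subsequence it is at least n while the normalized weight exceeds \<sigma>/2, so the
      bound makes \<open>p\<close> decay exponentially.\<close>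
    have bound: "exp (norm (w n) * \<sigma>n n) * cmod (p n) \<le> C'" for n
    proof -
      have "norm (w n) * \<sigma>n n = u1 n $ i + u1 n $ j + u2 n $ k + u2 n $ l"
        using wpos[of n] by (simp add: \<sigma>n_def distrib_left flip: mult.assoc)
      thus ?thesis using good[of n] by (simp add: good_def p_def)
    qed
    have "\<forall>\<^sub>F n in sequentially. norm (p (\<rho> n)) \<le> C' * exp (- (real n * (\<sigma> / 2)))"
      using ev
    proof eventually_elim
      case (elim n)
      have "real n \<le> norm (w (\<rho> n))"
        using wn[of "\<rho> n"] seq_suble[OF \<rho>(1), of n] by linarith
      hence "real n * (\<sigma> / 2) \<le> norm (w (\<rho> n)) * \<sigma>n (\<rho> n)"
        using elim \<open>\<sigma> > 0\<close> by (intro mult_mono) auto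
      hence "exp (real n * (\<sigma> / 2)) * cmod (p (\<rho> n)) \<le> C'"
        by (intro order.trans[OF _ bound[of "\<rho> n"]] mult_right_mono) auto
      thus ?case by (simp add: exp_minus field_simps)
    qed
    moreover have "(\<lambda>n. C' * exp (- (real n * (\<sigma> / 2)))) \<longlonglongrightarrow> 0"
    proof -
      have "filterlim (\<lambda>n. real n * (\<sigma> / 2)) at_top sequentially"
        using \<open>\<sigma> > 0\<close> by (intro filterlim_at_top_mult_tendsto_pos[OF tendsto_const _ filterlim_real_sequentially]) auto
      hence "(\<lambda>n. exp (- (real n * (\<sigma> / 2)))) \<longlonglongrightarrow> 0"
        by (intro filterlim_compose[OF exp_at_bot] filterlim_compose[OF filterlim_uminus_at_bot_at_top])
      thus ?thesis using tendsto_mult_right_zero by blast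
    qed
    ultimately have "(\<lambda>n. p (\<rho> n)) \<longlonglongrightarrow> 0"
      by (rule Lim_null_comparison)
    moreover have "(\<lambda>n. p (\<rho> n)) \<longlonglongrightarrow> polar h (A $ i) (A $ j) (B $ k) (B $ l)"
      unfolding p_def by (intro tendsto_polar assms tendsto_intros lim)
    ultimately show ?thesis using LIMSEQ_unique by blast
  qed
  with dets sums nz show ?thesis
    by (intro that[of A B "- r" "- s"]) (simp_all add: sum_negf)
qed

section \<open>Normal forms\<close>

text \<open>Dividing the first row of each matrix by the determinant puts the pair into G, and
  rescaling rows does not affect which coefficients vanish.\<close>

lemma orbit_normal_form:
  fixes A :: "complex^2^2" and B :: "complex^3^3"
  assumes "h \<in> V" "det A \<noteq> 0" "det B \<noteq> 0" "S \<subseteq> M"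
    and zero: "\<And>i j k l. index_monomial i j k l \<notin> S \<Longrightarrow> polar h (A $ i) (A $ j) (B $ k) (B $ l) = 0"
  shows "\<exists>f\<in>orbit h. f \<in> linear_combinations S"
proof -
  define \<alpha> where "\<alpha> = (\<lambda>i::2. if i = 1 then 1 / det A else 1)"
  define \<beta> where "\<beta> = (\<lambda>k::3. if k = 1 then 1 / det B else 1)"
  define A' where "A' = (\<chi> i. \<alpha> i *s A $ i)"
  define B' where "B' = (\<chi> k. \<beta> k *s B $ k)"
  have "A' = (\<chi> i. if i = 1 then (1 / det A) *s A $ 1 else A $ i)"
    "B' = (\<chi> k. if k = 1 then (1 / det B) *s B $ 1 else B $ k)"
    by (auto simp: A'_def B'_def \<alpha>_def \<beta>_def vec_eq_iff)
  hence "det A' = (1 / det A) * det (\<chi> i. if i = 1 then A $ 1 else A $ i)"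
    "det B' = (1 / det B) * det (\<chi> k. if k = 1 then B $ 1 else B $ k)"
    by (simp_all only: det_row_mul)
  moreover have "(\<chi> i. if i = 1 then A $ 1 else A $ i) = A" "(\<chi> k. if k = 1 then B $ 1 else B $ k) = B"
    by (auto simp: vec_eq_iff)
  ultimately have "(A', B') \<in> G"
    using assms(2,3) by (simp add: G_def)
  hence "act (A', B') h \<in> orbit h"
    unfolding orbit_def by (rule imageI)
  moreover have "act (A', B') h \<in> linear_combinations S"
  proof (rule linear_combinationsI[OF \<open>S \<subseteq> M\<close> _ act_tensor_form[OF assms(1)]])
    show "polar h (A' $ i) (A' $ j) (B' $ k) (B' $ l) = 0" if "index_monomial i j k l \<notin> S" for i j k l
      using zero[OF that] by (simp add: A'_def B'_def polar_scale[OF assms(1)])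
  qed
  ultimately show ?thesis by blast
qed

lemma index_monomial_in_M_plus:
  "index_monomial i j k l \<in> M_plus (r0, r1) (s0, s1, s2) \<longleftrightarrow>
    0 \<le> (if i = 1 then r0 else r1) + (if j = 1 then r0 else r1) +
      (if k = 1 then s0 else if k = 2 then s1 else s2) + (if l = 1 then s0 else if l = 2 then s1 else s2)"
  using exhaust_2[of i] exhaust_2[of j] exhaust_3[of k] exhaust_3[of l]
  by (elim disjE) (simp_all add: index_monomial_def M_def algebra_simps)

lemma M_plus_subset_M: "M_plus r s \<subseteq> M"
  by (cases r; cases s) auto

text \<open>In this lemma and the next two, the hypotheses list the monomials of negative weight, up
  to the symmetries of \<open>polar\<close>. Here these are the ones divisible by y_0^2 or y_0
  y_1.\<close>

lemma normal_form_0_0_m1_0_1: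
  fixes A :: "complex^2^2" and B :: "complex^3^3"
  assumes h: "h \<in> V" and det: "det A \<noteq> 0" "det B \<noteq> 0"
    and "\<And>i j. polar h (A $ i) (A $ j) (B $ 1) (B $ 1) = 0"
    and "\<And>i j. polar h (A $ i) (A $ j) (B $ 1) (B $ 2) = 0"
  shows "\<exists>f\<in>orbit h. f \<in> linear_combinations (M_plus (0, 0) (-1, 0, 1))"
proof (rule orbit_normal_form[OF h det M_plus_subset_M])
  show "polar h (A $ i) (A $ j) (B $ k) (B $ l) = 0"
    if "index_monomial i j k l \<notin> M_plus (0, 0) (-1, 0, 1)" for i j k l
    using that assms(4,5) polar_sym(2)[OF h, of _ _ "B $ 2" "B $ 1"] exhaust_3[of k] exhaust_3[of l]
    unfolding index_monomial_in_M_plus by (elim disjE) simp_all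
qed

lemma normal_form_m1_1_m2_0_2:
  fixes A :: "complex^2^2" and B :: "complex^3^3"
  assumes h: "h \<in> V" and det: "det A \<noteq> 0" "det B \<noteq> 0"
    and "polar h (A $ 1) (A $ 1) (B $ 1) (B $ 1) = 0" "polar h (A $ 1) (A $ 1) (B $ 1) (B $ 2) = 0"
      "polar h (A $ 1) (A $ 1) (B $ 2) (B $ 2) = 0" "polar h (A $ 1) (A $ 1) (B $ 1) (B $ 3) = 0"
    and "polar h (A $ 1) (A $ 2) (B $ 1) (B $ 1) = 0" "polar h (A $ 1) (A $ 2) (B $ 1) (B $ 2) = 0"
    and "polar h (A $ 2) (A $ 2) (B $ 1) (B $ 1) = 0"
  shows "\<exists>f\<in>orbit h. f \<in> linear_combinations (M_plus (-1, 1) (-2, 0, 2))"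
proof (rule orbit_normal_form[OF h det M_plus_subset_M])
  note sym = polar_sym(1)[OF h, of "A $ 2" "A $ 1"]
    polar_sym(2)[OF h, of _ _ "B $ 2" "B $ 1"] polar_sym(2)[OF h, of _ _ "B $ 3" "B $ 1"]
    polar_sym(2)[OF h, of _ _ "B $ 3" "B $ 2"]
  show "polar h (A $ i) (A $ j) (B $ k) (B $ l) = 0"
    if "index_monomial i j k l \<notin> M_plus (-1, 1) (-2, 0, 2)" for i j k l
    using that assms(4-) exhaust_2[of i] exhaust_2[of j] exhaust_3[of k] exhaust_3[of l]
    unfolding index_monomial_in_M_plus by (elim disjE) (simp_all add: sym)
qed

lemma normal_form_m1_1_m1_0_1:
  fixes A :: "complex^2^2" and B :: "complex^3^3"
  assumes h: "h \<in> V" and det: "det A \<noteq> 0" "det B \<noteq> 0"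
    and "\<And>k l. (k, l) \<noteq> (3, 3) \<Longrightarrow> polar h (A $ 1) (A $ 1) (B $ k) (B $ l) = 0"
    and "polar h (A $ 1) (A $ 2) (B $ 1) (B $ 1) = 0" "polar h (A $ 1) (A $ 2) (B $ 1) (B $ 2) = 0"
  shows "\<exists>f\<in>orbit h. f \<in> linear_combinations (M_plus (-1, 1) (-1, 0, 1))"
proof (rule orbit_normal_form[OF h det M_plus_subset_M])
  note sym = polar_sym(1)[OF h, of "A $ 2" "A $ 1"]
    polar_sym(2)[OF h, of _ _ "B $ 2" "B $ 1"]
  show "polar h (A $ i) (A $ j) (B $ k) (B $ l) = 0"
    if "index_monomial i j k l \<notin> M_plus (-1, 1) (-1, 0, 1)" for i j k l
    using that assms(4-) exhaust_2[of i] exhaust_2[of j] exhaust_3[of k] exhaust_3[of l]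
    unfolding index_monomial_in_M_plus by (elim disjE) (simp_all add: sym)
qed

section \<open>Changes of coordinates adapted to sorted weights\<close>

lemma sorting_permutation_2:
  fixes r :: "real^2"
  obtains p where "p permutes (UNIV :: 2 set)" "r $ p 1 \<le> r $ p 2"
proof (cases "r $ 1 \<le> r $ 2")
  case True
  thus ?thesis using that[of id] by (simp add: permutes_id)
next
  case False
  thus ?thesis using that[of "Transposition.transpose 1 2"] by (simp add: permutes_swap_id)
qed

lemma sorting_permutation_3:
  fixes s :: "real^3"
  obtains p where "p permutes (UNIV :: 3 set)" "s $ p 1 \<le> s $ p 2" "s $ p 2 \<le> s $ p 3"
proof -
  let ?t = "Transposition.transpose :: 3 \<Rightarrow> _"
  have perm: "?t a b permutes UNIV" "?t a b \<circ> ?t c d permutes UNIV" for a b c d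
    by (auto intro!: permutes_compose permutes_swap_id)
  consider "s $ 1 \<le> s $ 2" "s $ 2 \<le> s $ 3" | "s $ 1 \<le> s $ 3" "s $ 3 \<le> s $ 2"
    | "s $ 2 \<le> s $ 1" "s $ 1 \<le> s $ 3" | "s $ 2 \<le> s $ 3" "s $ 3 \<le> s $ 1"
    | "s $ 3 \<le> s $ 1" "s $ 1 \<le> s $ 2" | "s $ 3 \<le> s $ 2" "s $ 2 \<le> s $ 1"
    by linarith
  thus ?thesis
  proof cases
    case 1 thus ?thesis using that[of id] by (simp add: permutes_id)
  next
    case 2 thus ?thesis using that[OF perm(1)[of 2 3]] by (simp add: Transposition.transpose_def)
  next
    case 3 thus ?thesis using that[OF perm(1)[of 1 2]] by (simp add: Transposition.transpose_def)
  next
    \<comment> \<open>The two compositions are the two 3-cycles; one of them sorts here and the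
      other in the next case.\<close>
    case 4 thus ?thesis using that[OF perm(2)[of 1 2 2 3]] that[OF perm(2)[of 2 3 1 2]]
      by (simp add: Transposition.transpose_def)
  next
    case 5 thus ?thesis using that[OF perm(2)[of 1 2 2 3]] that[OF perm(2)[of 2 3 1 2]]
      by (simp add: Transposition.transpose_def)
  next
    case 6 thus ?thesis using that[OF perm(1)[of 1 3]] by (simp add: Transposition.transpose_def)
  qed
qed

lemma det_permute_rows_nonzero:
  fixes A :: "complex^'n::finite^'n"
  assumes "p permutes (UNIV :: 'n set)" "det A \<noteq> 0"
  shows "det (\<chi> i. A $ p i) \<noteq> 0"
  using assms by (simp add: det_permute_rows sign_def)

text \<open>If \<open>u\<close> is nonzero, a row operation on row p suffices. Otherwise rows p and
  q are swapped first, which is why row q may end up as either of the old rows.\<close>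

lemma replace_row:
  fixes B :: "complex^'n::finite^'n"
  assumes "det B \<noteq> 0" "p \<noteq> q" "(u, v) \<noteq> (0, 0)"
  obtains B' where "det B' \<noteq> 0" "B' $ p = u *s B $ p + v *s B $ q" "B' $ q = B $ p \<or> B' $ q = B $ q"
    "\<And>k. k \<noteq> p \<Longrightarrow> k \<noteq> q \<Longrightarrow> B' $ k = B $ k"
proof -
  have *: "\<exists>B'. det B' \<noteq> 0 \<and> B' $ p = u *s B $ p + v *s B $ q \<and> B' $ q = B $ q \<and>
      (\<forall>k. k \<noteq> p \<longrightarrow> k \<noteq> q \<longrightarrow> B' $ k = B $ k)"
    if "det B \<noteq> 0" "u \<noteq> 0" for u v and B :: "complex^'n^'n"
  proof -
    define B' where "B' = (\<chi> k. if k = p then u *s (row p B + (v / u) *s row q B) else row k B)"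
    have "det B' = u * det (\<chi> k. if k = p then row p B + (v / u) *s row q B else row k B)"
      unfolding B'_def by (rule det_row_mul)
    also have "\<dots> = u * det B"
      by (subst det_row_operation[OF assms(2)]) simp
    finally have "det B' \<noteq> 0" using that by simp
    moreover have "B' $ k = (if k = p then u *s B $ p + v *s B $ q else B $ k)" for k
      using that by (simp add: B'_def row_def vec_eq_iff field_simps)
    ultimately show ?thesis using assms(2) by (intro exI[of _ B']) simp
  qed
  show ?thesis
  proof (cases "u = 0")
    case False
    thus ?thesis using *[OF assms(1) False, of v] that by metis
  next
    case True
    let ?B = "\<chi> k. B $ Transposition.transpose p q k"
    have "det ?B \<noteq> 0"
      by (rule det_permute_rows_nonzero[OF permutes_swap_id assms(1)]) auto
    moreover have "v \<noteq> 0" using True assms(3) by simp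
    ultimately obtain B' where "det B' \<noteq> 0" "B' $ p = v *s ?B $ p + 0 *s ?B $ q" "B' $ q = ?B $ q"
      "\<And>k. k \<noteq> p \<Longrightarrow> k \<noteq> q \<Longrightarrow> B' $ k = ?B $ k"
      using *[of ?B v 0] by metis
    thus ?thesis
      using True by (intro that[of B']) simp_all
  qed
qed

lemma binary_quadratic_zero:
  fixes \<alpha> \<beta> \<gamma> :: complex
  obtains u v where "(u, v) \<noteq> (0, 0)" "\<alpha> * u\<^sup>2 + 2 * \<beta> * u * v + \<gamma> * v\<^sup>2 = 0"
proof (cases "\<alpha> = 0")
  case True
  thus ?thesis using that[of 1 0] by simp
next
  case False
  define u where "u = (csqrt (\<beta>\<^sup>2 - \<alpha> * \<gamma>) - \<beta>) / \<alpha>"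
  have "(\<alpha> * u + \<beta>)\<^sup>2 = \<beta>\<^sup>2 - \<alpha> * \<gamma>"
    using False by (simp add: u_def)
  hence "\<alpha> * (\<alpha> * u\<^sup>2 + 2 * \<beta> * u + \<gamma>) = 0"
    by (simp add: power2_eq_square algebra_simps)
  thus ?thesis using False that[of u 1] by simp
qed

text \<open>Over the complex numbers every line in the plane meets the conic given by
  \<open>polar h a a'\<close>.\<close>

lemma isotropic_combination:
  assumes "h \<in> V"
  obtains u v where "(u, v) \<noteq> (0, 0)"
    "polar h a a' (u *s b + v *s b') (u *s b + v *s b') = 0"
proof -
  obtain u v where "(u, v) \<noteq> (0, 0)"
    "polar h a a' b b * u\<^sup>2 + 2 * polar h a a' b b' * u * v + polar h a a' b' b' * v\<^sup>2 = 0"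
    using binary_quadratic_zero by metis
  thus ?thesis
    by (intro that[of u v]) (simp_all add: polar_add[OF assms] polar_scale[OF assms]
      polar_sym(2)[OF assms, of a a' b' b] power2_eq_square algebra_simps)
qed

text \<open>Sorted, the weights are (-R, R) and x \<le> y \<le> z with sum 0. Each case determines
  enough monomials of negative weight to reach one of the three normal forms, directly or after
  mixing rows.\<close>

lemma weights_imp_normal_form:
  fixes A :: "complex^2^2" and B :: "complex^3^3" and r :: "real^2" and s :: "real^3"
  assumes h: "h \<in> V" and det: "det A \<noteq> 0" "det B \<noteq> 0"
    and sum: "(\<Sum>i\<in>UNIV. r $ i) = 0" "(\<Sum>k\<in>UNIV. s $ k) = 0" and nz: "(r, s) \<noteq> 0"
    and vanish: "\<And>i j k l. r $ i + r $ j + s $ k + s $ l < 0 \<Longrightarrow> polar h (A $ i) (A $ j) (B $ k) (B $ l) = 0"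
  shows "\<exists>f \<in> orbit h.
            f \<in> linear_combinations (M_plus (0, 0) (-1, 0, 1)) \<or>
            f \<in> linear_combinations (M_plus (-1, 1) (-2, 0, 2)) \<or>
            f \<in> linear_combinations (M_plus (-1, 1) (-1, 0, 1))"
proof -
  note add = polar_add[OF h] and scale = polar_scale[OF h] and sym = polar_sym[OF h]
  obtain p where p: "p permutes UNIV" "r $ p 1 \<le> r $ p 2"
    by (rule sorting_permutation_2)
  obtain q where q: "q permutes UNIV" "s $ q 1 \<le> s $ q 2" "s $ q 2 \<le> s $ q 3"
    by (rule sorting_permutation_3)
  define A' where "A' = (\<chi> i. A $ p i)"
  define B' where "B' = (\<chi> k. B $ q k)"
  have det': "det A' \<noteq> 0" "det B' \<noteq> 0"
    unfolding A'_def B'_def using det p(1) q(1) by (simp_all only: det_permute_rows_nonzero not_False_eq_True)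
  define R where "R = r $ p 2"
  define x y z where "x = s $ q 1" and "y = s $ q 2" and "z = s $ q 3"
  have "(\<Sum>i\<in>UNIV. r $ p i) = 0" "(\<Sum>k\<in>UNIV. s $ q k) = 0"
    using sum sum.permute[OF p(1), of "\<lambda>i. r $ i"] sum.permute[OF q(1), of "\<lambda>k. s $ k"] by (simp_all add: o_def)
  hence R: "r $ p 1 = - R" "r $ p 2 = R" "R \<ge> 0" and xyz: "x + y + z = 0" "x \<le> y" "y \<le> z"
    using p(2) q(2,3) by (simp_all add: sum_2 sum_3 R_def x_def y_def z_def)
  have nonzero: "R \<noteq> 0 \<or> x \<noteq> 0"
  proof (rule ccontr)
    assume "\<not> ?thesis"
    hence "R = 0" "x = 0" "y = 0" "z = 0" using xyz by auto
    hence "\<forall>i. r $ p i = 0" "\<forall>k. s $ q k = 0"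
      using R by (simp_all add: forall_2 forall_3 x_def y_def z_def)
    moreover have "\<exists>i'. i = p i'" "\<exists>k'. k = q k'" for i k
      using permutes_surj[OF p(1)] permutes_surj[OF q(1)] by (auto simp: surj_def)
    ultimately have "r = 0" "s = 0" by (metis vec_eq_iff zero_index)+
    thus False using nz by (simp add: zero_prod_def)
  qed
  have H: "r $ p i + r $ p j + s $ q k + s $ q l < 0 \<Longrightarrow> polar h (A' $ i) (A' $ j) (B' $ k) (B' $ l) = 0" for i j k l
    unfolding A'_def B'_def by (simp add: vanish)
  have R2: "r $ p i + r $ p j \<le> 2 * R" for i j
    using exhaust_2[of i] exhaust_2[of j] R by auto
  \<comment> \<open>The inequalities decide the signs of the critical weights: 2R - z for x_1^2 y_0
    y_1, 2R + 2x for x_1^2 y_0^2, -2R - x for x_0^2 y_1 y_2, and 2y - 2R for x_0^2 y_1^2.\<close>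
  consider "R = 0" "x < 0" | "R > 0" "x = 0" | "R > 0" "x < 0" "2 * R < z" "R < - x" | "R > 0" "x < 0" "2 * R > - x"
    | "R > 0" "x < 0" "z \<le> 2 * R" "2 * R \<le> - x" "y < R" | "R > 0" "x < 0" "z \<le> 2 * R" "2 * R \<le> - x" "R \<le> y"
  proof -
    have "R = 0 \<or> R > 0" "x = 0 \<or> x < 0" "2 * R < z \<or> z \<le> 2 * R" "2 * R \<le> - x \<or> 2 * R > - x"
      "R \<le> y \<or> y < R" "2 * R \<le> - x \<Longrightarrow> R > 0 \<Longrightarrow> R < - x"
      using R(3) xyz by linarith+
    thus ?thesis using that nonzero by blast
  qed
  thus ?thesis
  proof cases
    case 1
    have "\<exists>f\<in>orbit h. f \<in> linear_combinations (M_plus (0, 0) (-1, 0, 1))"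
    proof (rule normal_form_0_0_m1_0_1[OF h det'])
      fix i j
      show "polar h (A' $ i) (A' $ j) (B' $ 1) (B' $ 1) = 0" "polar h (A' $ i) (A' $ j) (B' $ 1) (B' $ 2) = 0"
        using R2[of i j] 1 xyz by (auto intro!: H simp flip: x_def y_def z_def)
    qed
    thus ?thesis by blast
  next
    case 2
    hence "y = 0" "z = 0" using xyz by auto
    have H11: "polar h (A' $ 1) (A' $ 1) (B' $ k) (B' $ l) = 0" for k l
      using exhaust_3[of k] exhaust_3[of l] 2 \<open>y = 0\<close> \<open>z = 0\<close> by (intro H) (auto simp: R simp flip: x_def y_def z_def)
    \<comment> \<open>All of the x_0^2 part vanishes, so the rows of \<open>B'\<close> may be
      changed freely. A point of the conic attached to x_0 x_1 becomes the first row.\<close>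
    obtain u v where uv: "(u, v) \<noteq> (0, 0)"
      "polar h (A' $ 1) (A' $ 2) (u *s B' $ 1 + v *s B' $ 2) (u *s B' $ 1 + v *s B' $ 2) = 0"
      by (rule isotropic_combination[OF h])
    obtain B1 where B1: "det B1 \<noteq> 0" "B1 $ 1 = u *s B' $ 1 + v *s B' $ 2" "B1 $ 2 = B' $ 1 \<or> B1 $ 2 = B' $ 2"
      "\<And>k. k \<noteq> 1 \<Longrightarrow> k \<noteq> 2 \<Longrightarrow> B1 $ k = B' $ k"
      using replace_row[OF det'(2) _ uv(1), of 1 2] by auto
    \<comment> \<open>The polar linear form of that point; it vanishes on the first row, and its
      kernel is the tangent line if the point is smooth. A second row taken in the kernel kills the
      coefficient of x_0 x_1 y_0 y_1.\<close>
    define \<phi> where "\<phi> = (\<lambda>y. polar h (A' $ 1) (A' $ 2) (B1 $ 1) y)"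
    obtain u' v' where uv': "(u', v') \<noteq> (0, 0)" "u' * \<phi> (B1 $ 2) + v' * \<phi> (B1 $ 3) = 0"
    proof (cases "\<phi> (B1 $ 2) = 0")
      case True thus ?thesis using that[of 1 0] by simp
    next
      case False thus ?thesis using that[of "\<phi> (B1 $ 3)" "- \<phi> (B1 $ 2)"] by simp
    qed
    obtain B2 where B2: "det B2 \<noteq> 0" "B2 $ 2 = u' *s B1 $ 2 + v' *s B1 $ 3" "B2 $ 3 = B1 $ 2 \<or> B2 $ 3 = B1 $ 3"
      "\<And>k. k \<noteq> 2 \<Longrightarrow> k \<noteq> 3 \<Longrightarrow> B2 $ k = B1 $ k"
      using replace_row[OF B1(1) _ uv'(1), of 2 3] by auto
    have H11': "polar h (A' $ 1) (A' $ 1) (B1 $ k) (B1 $ l) = 0" for k l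
      using exhaust_3[of k] exhaust_3[of l] B1(2-4) H11 by (auto simp: add scale)
    have H11'': "polar h (A' $ 1) (A' $ 1) (B2 $ k) (B2 $ l) = 0" for k l
      using exhaust_3[of k] exhaust_3[of l] B2(2-4) H11' by (auto simp: add scale)
    have "\<exists>f\<in>orbit h. f \<in> linear_combinations (M_plus (-1, 1) (-1, 0, 1))"
    proof (rule normal_form_m1_1_m1_0_1[OF h det'(1) B2(1) H11''])
      show "polar h (A' $ 1) (A' $ 2) (B2 $ 1) (B2 $ 1) = 0"
        using uv(2) B1(2) B2(4)[of 1] by simp
      show "polar h (A' $ 1) (A' $ 2) (B2 $ 1) (B2 $ 2) = 0"
        using uv'(2) B2(4)[of 1] by (simp add: B2(2) add scale \<phi>_def)
    qed
    thus ?thesis by blast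
  next
    case 3
    have "\<exists>f\<in>orbit h. f \<in> linear_combinations (M_plus (0, 0) (-1, 0, 1))"
    proof (rule normal_form_0_0_m1_0_1[OF h det'])
      fix i j
      show "polar h (A' $ i) (A' $ j) (B' $ 1) (B' $ 1) = 0" "polar h (A' $ i) (A' $ j) (B' $ 1) (B' $ 2) = 0"
        using R2[of i j] 3 xyz by (auto intro!: H simp flip: x_def y_def z_def)
    qed
    thus ?thesis by blast
  next
    case 4
    have "\<exists>f\<in>orbit h. f \<in> linear_combinations (M_plus (-1, 1) (-1, 0, 1))"
    proof (rule normal_form_m1_1_m1_0_1[OF h det'])
      show "polar h (A' $ 1) (A' $ 1) (B' $ k) (B' $ l) = 0" if "(k, l) \<noteq> (3, 3)" for k l
        using exhaust_3[of k] exhaust_3[of l] that 4 xyz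
        by (intro H) (auto simp: R simp flip: x_def y_def z_def)
    qed (use 4 xyz in \<open>auto intro!: H simp: R simp flip: x_def y_def z_def\<close>)
    thus ?thesis by blast
  next
    case 5
    have "\<exists>f\<in>orbit h. f \<in> linear_combinations (M_plus (-1, 1) (-2, 0, 2))"
      by (rule normal_form_m1_1_m2_0_2[OF h det'])
        (use 5 xyz in \<open>auto intro!: H simp: R simp flip: x_def y_def z_def\<close>)
    thus ?thesis by blast
  next
    case 6
    \<comment> \<open>Here x_0^2 y_1^2 has nonnegative weight and need not vanish. But every
      coefficient involving x_0^2 y_0 or x_0 x_1 y_0 is 0, so the last two rows can be mixed to make
      the second row isotropic for the x_0^2 part without losing these zeros.\<close>
    have H1: "polar h (A' $ 1) (A' $ 1) (B' $ 1) (B' $ k) = 0" "polar h (A' $ 1) (A' $ 2) (B' $ 1) (B' $ k) = 0" for k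
      using exhaust_3[of k] 6 xyz by (auto intro!: H simp: R simp flip: x_def y_def z_def)
    have H22: "polar h (A' $ 2) (A' $ 2) (B' $ 1) (B' $ 1) = 0"
      using 6 xyz by (auto intro!: H simp: R simp flip: x_def y_def z_def)
    obtain u v where uv: "(u, v) \<noteq> (0, 0)"
      "polar h (A' $ 1) (A' $ 1) (u *s B' $ 2 + v *s B' $ 3) (u *s B' $ 2 + v *s B' $ 3) = 0"
      by (rule isotropic_combination[OF h])
    obtain B1 where B1: "det B1 \<noteq> 0" "B1 $ 2 = u *s B' $ 2 + v *s B' $ 3" "B1 $ 3 = B' $ 2 \<or> B1 $ 3 = B' $ 3"
      "\<And>k. k \<noteq> 2 \<Longrightarrow> k \<noteq> 3 \<Longrightarrow> B1 $ k = B' $ k"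
      using replace_row[OF det'(2) _ uv(1), of 2 3] by auto
    have "B1 $ 1 = B' $ 1" by (simp add: B1(4))
    have "\<exists>f\<in>orbit h. f \<in> linear_combinations (M_plus (-1, 1) (-2, 0, 2))"
      by (rule normal_form_m1_1_m2_0_2[OF h det'(1) B1(1)])
        (use uv(2) B1(3) H1 H22 in \<open>auto simp: \<open>B1 $ 1 = B' $ 1\<close> B1(2) add(4) scale(4)\<close>)
    thus ?thesis by blast
  qed
qed

text \<open>Three monomials separate the sets: x_0^2 y_1^2 lies only in the first; of the others,
  x_0^2 y_1 y_2 lies only in the second; and x_0^2 y_2^2 separates the last two.\<close>

lemma M_plus_distinct:
  "distinct [M_plus (0, 0) (-1, 0, 1), M_plus (-1, 1) (-2, 0, 2),
             M_plus (-1, 1) (-1, 0, 1), M_plus (-2, 2) (-1, 0, 1)]"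
proof -
  have neq: "S \<noteq> T" if "(m \<in> S) \<noteq> (m \<in> T)" for m and S T :: "monomial set"
    using that by auto
  show ?thesis
    using neq[of "index_monomial 1 1 2 2" "M_plus (0, 0) (-1, 0, 1)" "M_plus (-1, 1) (-2, 0, 2)"]
      neq[of "index_monomial 1 1 2 2" "M_plus (0, 0) (-1, 0, 1)" "M_plus (-1, 1) (-1, 0, 1)"]
      neq[of "index_monomial 1 1 2 2" "M_plus (0, 0) (-1, 0, 1)" "M_plus (-2, 2) (-1, 0, 1)"]
      neq[of "index_monomial 1 1 2 3" "M_plus (-1, 1) (-2, 0, 2)" "M_plus (-1, 1) (-1, 0, 1)"]
      neq[of "index_monomial 1 1 2 3" "M_plus (-1, 1) (-2, 0, 2)" "M_plus (-2, 2) (-1, 0, 1)"]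
      neq[of "index_monomial 1 1 3 3" "M_plus (-1, 1) (-1, 0, 1)" "M_plus (-2, 2) (-1, 0, 1)"]
    by (simp add: index_monomial_in_M_plus del: M_plus.simps)
qed

section \<open>One-parameter subgroups of the stabilizer\<close>

lemma entries_le_norm: "entries_le (norm A) A"
  unfolding entries_le_def
  by (intro allI order_trans[OF Finite_Cartesian_Product.norm_nth_le Finite_Cartesian_Product.norm_nth_le])

text \<open>\<open>E t\<close> is exp(t X), built entrywise as a power series. The entries of the
  k-th power of \<open>X\<close> are at most \<open>a ^ k\<close>, so each series is dominated by
  that of exp(a |t|).\<close>

lemma matrix_exponential:
  fixes X :: "complex^'n::finite^'n"
  obtains E :: "complex \<Rightarrow> complex^'n^'n" where "E 0 = mat 1"
    "\<And>t i j. ((\<lambda>t. E t $ i $ j) has_field_derivative (E t ** X) $ i $ j) (at t)"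
proof -
  define P where "P k = ((\<lambda>Y. Y ** X) ^^ k) (mat 1)" for k
  have P: "P 0 = mat 1" "P (Suc k) = P k ** X" for k by (simp_all add: P_def)
  define a where "a = real CARD('n) * norm X"
  have "entries_le (a ^ k) (P k)" for k
  proof (induction k)
    case 0 show ?case by (simp add: P entries_le_def mat_def)
  next
    case (Suc k)
    have "0 \<le> a ^ k" by (simp add: a_def)
    from entries_le_mult[OF Suc entries_le_norm[of X] this] show ?case
      by (simp add: P a_def mult_ac)
  qed
  hence P_le: "cmod (P k $ i $ j) \<le> a ^ k" for k i j by (simp add: entries_le_def)
  define c where "c i j k = P k $ i $ j / fact k" for i j k
  have summable: "summable (\<lambda>k. c i j k * t ^ k)" for i j t
  proof (rule summable_comparison_test')
    show "summable (\<lambda>k. inverse (fact k) * (a * cmod t) ^ k)" by (rule summable_exp)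
    show "norm (c i j k * t ^ k) \<le> inverse (fact k) * (a * cmod t) ^ k" for k
      using P_le[of k i j]
      by (simp add: c_def norm_mult norm_divide norm_power power_mult_distrib divide_simps mult_right_mono)
  qed
  define E where "E t = (\<chi> i j. \<Sum>k. c i j k * t ^ k)" for t
  have "E 0 = mat 1"
    unfolding E_def by (simp add: vec_eq_iff) (simp add: c_def P)
  moreover have "((\<lambda>t. E t $ i $ j) has_field_derivative (E t ** X) $ i $ j) (at t)" for t i j
  proof -
    \<comment> \<open>Termwise differentiation cancels one factor of the factorial and leaves the
      power k + 1 of \<open>X\<close>, that is, one more factor \<open>X\<close> on the
      right.\<close>
    have "diffs (c i j) k = (\<Sum>l\<in>UNIV. c i l k * X $ l $ j)" for k
    proof -
      have "diffs (c i j) k = P (Suc k) $ i $ j / fact k"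
        by (simp add: diffs_def c_def del: of_nat_Suc)
      thus ?thesis by (simp add: c_def P matrix_matrix_mult_def sum_divide_distrib)
    qed
    hence "diffs (c i j) k * t ^ k = (\<Sum>l\<in>UNIV. c i l k * t ^ k * X $ l $ j)" for k
      by (simp add: sum_distrib_left mult_ac)
    hence "(\<Sum>k. diffs (c i j) k * t ^ k) = (\<Sum>l\<in>UNIV. (\<Sum>k. c i l k * t ^ k) * X $ l $ j)"
      by (simp add: suminf_sum summable_mult2 summable suminf_mult2)
    also have "\<dots> = (E t ** X) $ i $ j"
      by (simp add: E_def matrix_matrix_mult_def)
    finally show ?thesis
      using termdiffs_strong_converges_everywhere[of "c i j" t] summable by (simp add: E_def)
  qed
  ultimately show ?thesis by (rule that)
qed

lemma has_field_derivative_polar: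
  assumes "h \<in> V"
    and "\<And>i. ((\<lambda>t. a t $ i) has_field_derivative da $ i) (at t)"
    and "\<And>i. ((\<lambda>t. a' t $ i) has_field_derivative da' $ i) (at t)"
    and "\<And>i. ((\<lambda>t. b t $ i) has_field_derivative db $ i) (at t)"
    and "\<And>i. ((\<lambda>t. b' t $ i) has_field_derivative db' $ i) (at t)"
  shows "((\<lambda>t. polar h (a t) (a' t) (b t) (b' t)) has_field_derivative
    polar h da (a' t) (b t) (b' t) + polar h (a t) da' (b t) (b' t) +
    polar h (a t) (a' t) db (b' t) + polar h (a t) (a' t) (b t) db') (at t)"
proof -
  obtain c where c: "polar h = tensor_form c"
    using polar_eq_tensor_form[OF assms(1)] by metis
  have "((\<lambda>t. c i j k l * a t $ i * a' t $ j * b t $ k * b' t $ l) has_field_derivative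
    c i j k l * da $ i * a' t $ j * b t $ k * b' t $ l + c i j k l * a t $ i * da' $ j * b t $ k * b' t $ l +
    c i j k l * a t $ i * a' t $ j * db $ k * b' t $ l + c i j k l * a t $ i * a' t $ j * b t $ k * db' $ l) (at t)"
    for i j k l
    by (auto intro!: derivative_eq_intros assms simp: algebra_simps)
  hence "((\<lambda>t. tensor_form c (a t) (a' t) (b t) (b' t)) has_field_derivative
    (\<Sum>i\<in>UNIV. \<Sum>j\<in>UNIV. \<Sum>k\<in>UNIV. \<Sum>l\<in>UNIV.
      c i j k l * da $ i * a' t $ j * b t $ k * b' t $ l + c i j k l * a t $ i * da' $ j * b t $ k * b' t $ l +
      c i j k l * a t $ i * a' t $ j * db $ k * b' t $ l + c i j k l * a t $ i * a' t $ j * b t $ k * db' $ l)) (at t)"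
    unfolding tensor_form_def by (intro DERIV_sum)
  thus ?thesis
    unfolding c by (simp add: tensor_form_def sum.distrib)
qed

text \<open>Jacobi's formula for a solution of E' = E X; for trace 0 it keeps the determinant
  constant. The same is expanded for size 3 below.\<close>

lemma has_field_derivative_det_2:
  fixes E :: "complex \<Rightarrow> complex^2^2"
  assumes "\<And>i j. ((\<lambda>t. E t $ i $ j) has_field_derivative (E t ** X) $ i $ j) (at t)"
  shows "((\<lambda>t. det (E t)) has_field_derivative trace X * det (E t)) (at t)"
  unfolding det_2
  by (rule derivative_eq_intros assms refl)+
    (simp add: matrix_matrix_mult_def sum_2 trace_def algebra_simps)

lemma has_field_derivative_det_3:
  fixes E :: "complex \<Rightarrow> complex^3^3"
  assumes "\<And>i j. ((\<lambda>t. E t $ i $ j) has_field_derivative (E t ** X) $ i $ j) (at t)"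
  shows "((\<lambda>t. det (E t)) has_field_derivative trace X * det (E t)) (at t)"
  unfolding det_3
  by (rule derivative_eq_intros assms refl)+
    (simp add: matrix_matrix_mult_def sum_3 trace_def algebra_simps)

lemma constant_if_derivative_zero:
  fixes f :: "complex \<Rightarrow> complex"
  assumes "\<And>t. (f has_field_derivative 0) (at t)"
  shows "f t = f 0"
  using has_field_derivative_zero_constant[of UNIV f] assms by (metis UNIV_I convex_UNIV)

text \<open>The hypotheses on X1 and X2 say that the pair lies in the Lie algebra of the stabilizer.\<close>

lemma one_parameter_subgroup_in_stabilizer:
  assumes "h \<in> V" "trace X1 = 0" "trace X2 = 0"
    and inv: "\<And>x y. polar h x (x v* X1) y y + polar h x x y (y v* X2) = 0"
    and E1: "E1 0 = mat 1" "\<And>t i j. ((\<lambda>t. E1 t $ i $ j) has_field_derivative (E1 t ** X1) $ i $ j) (at t)"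
    and E2: "E2 0 = mat 1" "\<And>t i j. ((\<lambda>t. E2 t $ i $ j) has_field_derivative (E2 t ** X2) $ i $ j) (at t)"
  shows "(E1 t, E2 t) \<in> stabilizer h"
proof -
  have "det (E1 t) = det (E1 0)" 
    using has_field_derivative_det_2[OF E1(2)] assms(2)
    by (intro constant_if_derivative_zero[of "\<lambda>t. det (E1 t)"]) simp
  moreover have "det (E2 t) = det (E2 0)" 
    using has_field_derivative_det_3[OF E2(2)] assms(3)
    by (intro constant_if_derivative_zero[of "\<lambda>t. det (E2 t)"]) simp
  moreover have "act (E1 t, E2 t) h (x, y) = h (x, y)" for x y
  proof -
    \<comment> \<open>The value of \<open>h\<close> along the curve through (x, y). Its derivative
      is twice the left side of \<open>inv\<close> at the moved point, hence 0.\<close>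
    define \<phi> where "\<phi> t = polar h (x v* E1 t) (x v* E1 t) (y v* E2 t) (y v* E2 t)" for t
    have d1: "((\<lambda>t. (x v* E1 t) $ j) has_field_derivative ((x v* E1 t) v* X1) $ j) (at t)" for t j
      unfolding vector_matrix_mul_assoc
      unfolding vector_matrix_mult_def by (auto intro!: derivative_eq_intros E1 simp: mult.commute)
    have d2: "((\<lambda>t. (y v* E2 t) $ j) has_field_derivative ((y v* E2 t) v* X2) $ j) (at t)" for t j
      unfolding vector_matrix_mul_assoc
      unfolding vector_matrix_mult_def by (auto intro!: derivative_eq_intros E2 simp: mult.commute)
    have "(\<phi> has_field_derivative 0) (at t)" for t
    proof -
      let ?x = "x v* E1 t" and ?y = "y v* E2 t"
      have "polar h (?x v* X1) ?x ?y ?y + polar h ?x (?x v* X1) ?y ?y +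
        polar h ?x ?x (?y v* X2) ?y + polar h ?x ?x ?y (?y v* X2) =
        2 * (polar h ?x (?x v* X1) ?y ?y + polar h ?x ?x ?y (?y v* X2))"
        by (simp add: polar_sym(1)[OF assms(1), of "?x v* X1"] polar_sym(2)[OF assms(1), of _ _ "?y v* X2"])
      hence "polar h (?x v* X1) ?x ?y ?y + polar h ?x (?x v* X1) ?y ?y +
        polar h ?x ?x (?y v* X2) ?y + polar h ?x ?x ?y (?y v* X2) = 0"
        by (simp add: inv)
      thus ?thesis
        using has_field_derivative_polar[OF assms(1) d1 d1 d2 d2, of t] by (simp add: \<phi>_def[abs_def])
    qed
    hence "\<phi> t = \<phi> 0" by (rule constant_if_derivative_zero)
    thus ?thesis
      by (simp add: \<phi>_def E1 E2 polar_diag[OF assms(1)])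
  qed
  ultimately show ?thesis
    by (auto simp: stabilizer_def G_def E1 E2 fun_eq_iff)
qed

text \<open>For g in the stabilizer the coefficients of g h are those of \<open>h\<close>, so the
  largest of their moduli serves as the bound.\<close>

lemma stabilizer_subset_bounded_elements: "\<exists>C. stabilizer h \<subseteq> bounded_elements h C"
proof -
  let ?f = "\<lambda>(i, j, k, l). cmod (polar h (axis i 1) (axis j 1) (axis k 1) (axis l 1))"
  have "stabilizer h \<subseteq> bounded_elements h (Max (range ?f))"
  proof
    fix g assume g: "g \<in> stabilizer h"
    obtain A B where AB: "g = (A, B)" by force
    have "act (A, B) h = h" "(A, B) \<in> G" using g by (auto simp: AB stabilizer_def)
    have "cmod (polar h (A $ i) (A $ j) (B $ k) (B $ l)) \<le> Max (range ?f)" for i j k l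
    proof (rule Max_ge)
      have "polar h (A $ i) (A $ j) (B $ k) (B $ l) =
        polar (act (A, B) h) (axis i 1) (axis j 1) (axis k 1) (axis l 1)"
        by (simp add: polar_act axis_vector_matrix_mult del: act.simps)
      thus "cmod (polar h (A $ i) (A $ j) (B $ k) (B $ l)) \<in> range ?f"
        unfolding \<open>act (A, B) h = h\<close> by (auto intro!: image_eqI[of _ _ "(i, j, k, l)"])
    qed simp
    thus "g \<in> bounded_elements h (Max (range ?f))"
      using \<open>(A, B) \<in> G\<close> by (simp add: AB bounded_elements_def)
  qed
  thus ?thesis ..
qed

lemma no_infinitesimal_stabilizer:
  assumes "h \<in> V" "bounded (stabilizer h)" "trace X1 = 0" "trace X2 = 0"
    and inv: "\<And>x y. polar h x (x v* X1) y y + polar h x x y (y v* X2) = 0"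
  shows "X1 = 0" "X2 = 0"
proof -
  obtain E1 where E1: "E1 0 = mat 1" "\<And>t i j. ((\<lambda>t. E1 t $ i $ j) has_field_derivative (E1 t ** X1) $ i $ j) (at t)"
    using matrix_exponential[of X1] by metis
  obtain E2 where E2: "E2 0 = mat 1" "\<And>t i j. ((\<lambda>t. E2 t $ i $ j) has_field_derivative (E2 t ** X2) $ i $ j) (at t)"
    using matrix_exponential[of X2] by metis
  obtain b where b: "\<And>g. g \<in> stabilizer h \<Longrightarrow> norm g \<le> b"
    using assms(2) by (auto simp: bounded_iff)
  have "norm (E1 t, E2 t) \<le> b" for t
    by (rule b, rule one_parameter_subgroup_in_stabilizer[OF assms(1,3,4) inv E1 E2])
  hence le: "norm (E1 t) \<le> b" "norm (E2 t) \<le> b" for t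
    using norm_fst_le[of "E1 t" "E2 t"] norm_snd_le[of "E2 t" "E1 t"] order_trans by blast+
  \<comment> \<open>By Liouville's theorem a bounded entire function is constant. It is applied to
    the entries of \<open>E1\<close> and \<open>E2\<close>, whose derivatives at 0 are the entries
    of \<open>X1\<close> and \<open>X2\<close>.\<close>
  have zero: "f' 0 = 0" if "\<And>t. (f has_field_derivative f' t) (at t)" "\<And>t. cmod (f t) \<le> b" for f f' :: "complex \<Rightarrow> complex"
  proof -
    have "f holomorphic_on UNIV"
      using that(1) by (auto simp: holomorphic_on_def field_differentiable_def)
    moreover have "bounded (range f)" using that(2) by (auto simp: bounded_iff)
    ultimately obtain c where "f = (\<lambda>_. c)"
      using Liouville_theorem by (auto simp: constant_on_def fun_eq_iff)
    thus ?thesis using that(1)[of 0] DERIV_const DERIV_unique by blast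
  qed
  have "(E1 0 ** X1) $ i $ j = 0" for i j
    using entries_le_norm[of "E1 _"] le(1)
    by (intro zero[of "\<lambda>t. E1 t $ i $ j" "\<lambda>t. (E1 t ** X1) $ i $ j", OF E1(2)])
      (meson entries_le_def order_trans)
  thus "X1 = 0" by (simp add: E1 vec_eq_iff)
  have "(E2 0 ** X2) $ i $ j = 0" for i j
    using entries_le_norm[of "E2 _"] le(2)
    by (intro zero[of "\<lambda>t. E2 t $ i $ j" "\<lambda>t. (E2 t ** X2) $ i $ j", OF E2(2)])
      (meson entries_le_def order_trans)
  thus "X2 = 0" by (simp add: E2 vec_eq_iff)
qed

section \<open>Finiteness of a bounded stabilizer\<close>

lemma act_act: "act (A, B) (act (A', B') h) = act (A ** A', B ** B') h"
  by (simp add: fun_eq_iff vector_matrix_mul_assoc)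

lemma stabilizer_left_quotient:
  assumes "(A, B) \<in> stabilizer h" "(A', B') \<in> stabilizer h" "P ** A = mat 1" "Q ** B = mat 1"
  shows "(P ** A', Q ** B') \<in> stabilizer h"
proof -
  have dets: "det A = 1" "det B = 1" "det A' = 1" "det B' = 1"
    and inv: "act (A, B) h = h" "act (A', B') h = h"
    using assms(1,2) by (auto simp: stabilizer_def G_def)
  have "det P * det A = 1" "det Q * det B = 1"
    using assms(3,4) by (simp_all flip: det_mul)
  hence "det P = 1" "det Q = 1" by (simp_all add: dets)
  have "act (P ** A', Q ** B') h = act (P, Q) h"
    by (simp only: inv flip: act_act)
  also have "\<dots> = act (P, Q) (act (A, B) h)"
    by (simp only: inv)
  also have "\<dots> = h"
    unfolding act_act assms(3,4) by (simp add: fun_eq_iff)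
  finally show ?thesis
    using \<open>det P = 1\<close> \<open>det Q = 1\<close> by (simp add: stabilizer_def G_def det_mul dets del: act.simps)
qed

lemma closed_stabilizer:
  assumes "h \<in> V"
  shows "closed (stabilizer h)"
proof -
  have "stabilizer h = {g. det (fst g) = 1} \<inter> {g. det (snd g) = 1} \<inter> (\<Inter>p. {g. act g h p = h p})"
    by (auto simp: stabilizer_def G_def fun_eq_iff simp del: act.simps)
  also have "closed \<dots>"
    by (intro closed_Int closed_INT ballI closed_Collect_eq continuous_intros
        continuous_on_product_then_coordinatewise[OF continuous_on_act[OF assms]])
  finally show ?thesis .
qed

lemma tendsto_matrix_mult:
  fixes A :: "complex^'n::finite^'m"
  assumes "(f \<longlongrightarrow> B) F"
  shows "((\<lambda>z. A ** f z) \<longlongrightarrow> A ** B) F"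
  unfolding matrix_matrix_mult_def by (intro tendsto_intros assms)

text \<open>A bounded infinite stabilizer has a limit point \<open>g\<close>, which belongs to it by
  closedness. Translation by the inverse of \<open>g\<close> moves the accumulation to the
  identity.\<close>

lemma stabilizer_accumulates_at_one:
  assumes "h \<in> V" "bounded (stabilizer h)" "infinite (stabilizer h)"
  obtains k where "\<And>n. k n \<in> stabilizer h - {(mat 1, mat 1)}" "k \<longlonglongrightarrow> (mat 1, mat 1)"
proof -
  obtain g where "g islimpt stabilizer h"
    using bounded_infinite_imp_islimpt[OF subset_refl assms(2,3)] .
  then obtain f where f: "\<And>n. f n \<in> stabilizer h - {g}" "f \<longlonglongrightarrow> g"
    by (auto simp: islimpt_sequential)
  have "g \<in> stabilizer h"
    using \<open>g islimpt _\<close> closed_stabilizer[OF assms(1)] closed_limpt by blast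
  obtain A B where g: "g = (A, B)" by force
  have "det A = 1" "det B = 1" using \<open>g \<in> _\<close> by (auto simp: g stabilizer_def G_def)
  hence "invertible A" "invertible B" by (simp_all add: invertible_det_nz)
  then obtain P Q where PQ: "P ** A = mat 1" "Q ** B = mat 1" "A ** P = mat 1" "B ** Q = mat 1"
    unfolding invertible_def by blast
  define k where "k n = (P ** fst (f n), Q ** snd (f n))" for n
  show ?thesis
  proof (rule that[of k])
    fix n
    have "k n \<noteq> (mat 1, mat 1)"
    proof
      assume "k n = (mat 1, mat 1)"
      hence "A ** (P ** fst (f n)) = A ** mat 1" "B ** (Q ** snd (f n)) = B ** mat 1"
        by (simp_all add: k_def)
      hence "f n = g" by (simp add: g matrix_mul_assoc PQ prod_eq_iff)
      thus False using f(1) by blast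
    qed
    moreover have "k n \<in> stabilizer h"
      unfolding k_def using f(1)[of n] \<open>g \<in> _\<close> g by (intro stabilizer_left_quotient[OF _ _ PQ(1,2)]) auto
    ultimately show "k n \<in> stabilizer h - {(mat 1, mat 1)}" by blast
  next
    have "(\<lambda>n. (P ** fst (f n), Q ** snd (f n))) \<longlonglongrightarrow> (P ** fst g, Q ** snd g)"
      by (intro tendsto_Pair tendsto_matrix_mult tendsto_fst tendsto_snd f(2))
    thus "k \<longlonglongrightarrow> (mat 1, mat 1)"
      by (simp add: k_def[abs_def] g PQ)
  qed
qed

text \<open>Division by \<epsilon> isolates the first-order term. This differentiates an identity at
  the group identity along a mere sequence, where no curve in the stabilizer is at hand yet.\<close>

lemma first_order_limit_zero:
  fixes \<epsilon> c d :: "nat \<Rightarrow> complex"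
  assumes "\<And>n. \<epsilon> n * c n + (\<epsilon> n)\<^sup>2 * d n = 0" "\<And>n. \<epsilon> n \<noteq> 0"
    and "\<epsilon> \<longlonglongrightarrow> 0" "c \<longlonglongrightarrow> c'" "d \<longlonglongrightarrow> d'"
  shows "c' = 0"
proof -
  have "c n + \<epsilon> n * d n = 0" for n
  proof -
    have "\<epsilon> n * (c n + \<epsilon> n * d n) = 0"
      using assms(1)[of n] by (simp add: power2_eq_square algebra_simps)
    thus ?thesis using assms(2)[of n] by simp
  qed
  moreover have "(\<lambda>n. c n + \<epsilon> n * d n) \<longlonglongrightarrow> c' + 0 * d'"
    by (intro tendsto_intros assms)
  ultimately show ?thesis by (simp add: LIMSEQ_const_iff)
qed

text \<open>The trace is the first-order term of det(1 + \<epsilon> Y), and in size 2 the remaining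
  term is \<epsilon>^2 det Y.\<close>

lemma trace_limit_zero_2:
  fixes Y :: "nat \<Rightarrow> complex^2^2"
  assumes det: "\<And>n. det (mat 1 + \<epsilon> n *\<^sub>R Y n) = 1"
    and "\<And>n. \<epsilon> n \<noteq> 0" "\<epsilon> \<longlonglongrightarrow> 0" "Y \<longlonglongrightarrow> X"
  shows "trace X = 0"
proof (rule first_order_limit_zero[of "\<lambda>n. of_real (\<epsilon> n)" "\<lambda>n. trace (Y n)" "\<lambda>n. det (Y n)"])
  show "of_real (\<epsilon> n) * trace (Y n) + (of_real (\<epsilon> n))\<^sup>2 * det (Y n) = 0" for n
    using det[of n] by (simp add: det_2 trace_def sum_2 mat_def scaleR_conv_of_real[where 'a=complex]
        power2_eq_square algebra_simps)
  show "(\<lambda>n. complex_of_real (\<epsilon> n)) \<longlonglongrightarrow> 0"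
    using tendsto_of_real[OF assms(3)] by simp
  show "(\<lambda>n. trace (Y n)) \<longlonglongrightarrow> trace X" "(\<lambda>n. det (Y n)) \<longlonglongrightarrow> det X"
    unfolding trace_def det_def by (intro tendsto_intros assms)+
qed (use assms in auto)

lemma trace_limit_zero_3:
  fixes Y :: "nat \<Rightarrow> complex^3^3"
  assumes det: "\<And>n. det (mat 1 + \<epsilon> n *\<^sub>R Y n) = 1"
    and "\<And>n. \<epsilon> n \<noteq> 0" "\<epsilon> \<longlonglongrightarrow> 0" "Y \<longlonglongrightarrow> X"
  shows "trace X = 0"
proof -
  \<comment> \<open>The sum of the principal 2 by 2 minors, which is the coefficient of \<epsilon>^2
    in det(1 + \<epsilon> Z).\<close>
  define m where "m Z = Z $ 1 $ 1 * Z $ 2 $ 2 - Z $ 1 $ 2 * Z $ 2 $ 1 + Z $ 1 $ 1 * Z $ 3 $ 3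
    - Z $ 1 $ 3 * Z $ 3 $ 1 + Z $ 2 $ 2 * Z $ 3 $ 3 - Z $ 2 $ 3 * Z $ 3 $ 2" for Z :: "complex^3^3"
  have of_real: "(\<lambda>n. complex_of_real (\<epsilon> n)) \<longlonglongrightarrow> 0"
    using tendsto_of_real[OF assms(3)] by simp
  show ?thesis
  proof (rule first_order_limit_zero[of "\<lambda>n. of_real (\<epsilon> n)" "\<lambda>n. trace (Y n)"
        "\<lambda>n. m (Y n) + of_real (\<epsilon> n) * det (Y n)"])
    show "of_real (\<epsilon> n) * trace (Y n) + (of_real (\<epsilon> n))\<^sup>2 * (m (Y n) + of_real (\<epsilon> n) * det (Y n)) = 0" for n
      using det[of n] by (simp add: det_3 m_def trace_def sum_3 mat_def scaleR_conv_of_real[where 'a=complex]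
          power2_eq_square algebra_simps)
    show "(\<lambda>n. trace (Y n)) \<longlonglongrightarrow> trace X"
      unfolding trace_def by (intro tendsto_intros assms)
    show "(\<lambda>n. m (Y n) + of_real (\<epsilon> n) * det (Y n)) \<longlonglongrightarrow> m X + 0 * det X"
      unfolding m_def det_def by (intro tendsto_intros assms of_real)
  qed (use assms of_real in auto)
qed

text \<open>The conclusion is the first-order part, up to a factor 2, of the invariance of
  \<open>h\<close> under elements tending to the identity.\<close>

lemma invariance_limit:
  assumes h: "h \<in> V"
    and inv: "\<And>n. act (mat 1 + \<epsilon> n *\<^sub>R Y1 n, mat 1 + \<epsilon> n *\<^sub>R Y2 n) h = h"
    and "\<And>n. \<epsilon> n \<noteq> 0" "\<epsilon> \<longlonglongrightarrow> 0" "Y1 \<longlonglongrightarrow> X1" "Y2 \<longlonglongrightarrow> X2"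
  shows "polar h x (x v* X1) y y + polar h x x y (y v* X2) = 0"
proof -
  define e where "e n = complex_of_real (\<epsilon> n)" for n
  define p where "p n = x v* Y1 n" for n
  define q where "q n = y v* Y2 n" for n
  have e: "e \<longlonglongrightarrow> 0"
    using tendsto_of_real[OF assms(4)] by (simp add: e_def[abs_def])
  have pq: "p \<longlonglongrightarrow> x v* X1" "q \<longlonglongrightarrow> y v* X2"
    unfolding p_def[abs_def] q_def[abs_def] vector_matrix_mult_def by (intro tendsto_intros assms)+
  have H: "polar h x x y y = polar h (x + e n *s p n) (x + e n *s p n) (y + e n *s q n) (y + e n *s q n)" for n
  proof -
    have "x v* (mat 1 + \<epsilon> n *\<^sub>R Y1 n) = x + e n *s p n"
      by (simp add: vec_eq_iff vector_matrix_mult_def p_def e_def mat_def distrib_left sum.distrib sum_distrib_left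
          distrib_right scaleR_conv_of_real[where 'a=complex] mult_ac if_distrib[of "\<lambda>z. _ * z"] cong: if_cong)
    moreover have "y v* (mat 1 + \<epsilon> n *\<^sub>R Y2 n) = y + e n *s q n"
      by (simp add: vec_eq_iff vector_matrix_mult_def q_def e_def mat_def distrib_left sum.distrib sum_distrib_left
          distrib_right scaleR_conv_of_real[where 'a=complex] mult_ac if_distrib[of "\<lambda>z. _ * z"] cong: if_cong)
    ultimately show ?thesis
      using inv[of n] unfolding polar_diag[OF h] by (metis act.simps case_prod_conv)
  qed
  \<comment> \<open>All terms of order at least 2 in \<open>e n\<close> in the expansion of
    \<open>H\<close>, divided by the square of \<open>e n\<close>.\<close>
  define R where "R n = polar h (p n) (p n) y y + 4 * polar h x (p n) y (q n) + polar h x x (q n) (q n)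
    + e n * (2 * polar h (p n) (p n) y (q n) + 2 * polar h x (p n) (q n) (q n))
    + (e n)\<^sup>2 * polar h (p n) (p n) (q n) (q n)" for n
  have "2 * polar h x (x v* X1) y y + 2 * polar h x x y (y v* X2) = 0"
  proof (rule first_order_limit_zero[of e "\<lambda>n. 2 * polar h x (p n) y y + 2 * polar h x x y (q n)" R])
    show "e n * (2 * polar h x (p n) y y + 2 * polar h x x y (q n)) + (e n)\<^sup>2 * R n = 0" for n
      using H[of n]
      by (simp add: R_def polar_add[OF h] polar_scale[OF h] polar_sym(1)[OF h, of "p n" x]
          polar_sym(2)[OF h, of _ _ "q n" y] power2_eq_square algebra_simps)
    show "(\<lambda>n. 2 * polar h x (p n) y y + 2 * polar h x x y (q n)) \<longlonglongrightarrow>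
        2 * polar h x (x v* X1) y y + 2 * polar h x x y (y v* X2)"
      by (intro tendsto_intros h pq)
    show "R \<longlonglongrightarrow> polar h (x v* X1) (x v* X1) y y + 4 * polar h x (x v* X1) y (y v* X2)
      + polar h x x (y v* X2) (y v* X2)
      + 0 * (2 * polar h (x v* X1) (x v* X1) y (y v* X2) + 2 * polar h x (x v* X1) (y v* X2) (y v* X2))
      + 0\<^sup>2 * polar h (x v* X1) (x v* X1) (y v* X2) (y v* X2)"
      unfolding R_def[abs_def] by (intro tendsto_intros h pq e)
  qed (use e assms(3) in \<open>auto simp: e_def\<close>)
  hence "2 * (polar h x (x v* X1) y y + polar h x x y (y v* X2)) = 0"
    by (simp only: distrib_left)
  thus ?thesis
    by (simp only: mult_eq_0_iff) simp
qed

lemma finite_stabilizer: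
  assumes "h \<in> V" and bdd: "bounded (stabilizer h)"
  shows "finite (stabilizer h)"
proof (rule ccontr)
  assume "infinite (stabilizer h)"
  then obtain k where k: "\<And>n. k n \<in> stabilizer h - {(mat 1, mat 1)}" "k \<longlonglongrightarrow> (mat 1, mat 1)"
    using stabilizer_accumulates_at_one[OF assms] by metis
  \<comment> \<open>Each \<open>k n\<close> is the identity plus \<epsilon> times a unit vector
    \<open>Y n\<close>. A limit of the \<open>Y n\<close> is a unit vector in the Lie algebra of the
    stabilizer, which boundedness excludes.\<close>
  define \<epsilon> where "\<epsilon> n = norm (k n - (mat 1, mat 1))" for n
  define Y where "Y n = (k n - (mat 1, mat 1)) /\<^sub>R \<epsilon> n" for n
  have pos: "\<epsilon> n > 0" for n using k(1)[of n] by (auto simp: \<epsilon>_def)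
  have norm_Y: "norm (Y n) = 1" for n
    using pos[of n] by (simp add: Y_def) (simp add: \<epsilon>_def)
  have "(\<lambda>n. norm (k n - (mat 1, mat 1))) \<longlonglongrightarrow> norm ((mat 1, mat 1) - (mat 1, mat 1) :: (complex^2^2) \<times> (complex^3^3))"
    by (intro tendsto_intros k(2))
  hence \<epsilon>: "\<epsilon> \<longlonglongrightarrow> 0" by (simp add: \<epsilon>_def[abs_def])
  have "bounded (range Y)" using norm_Y by (auto simp: bounded_iff)
  then obtain X \<rho> where \<rho>: "strict_mono \<rho>" "(Y \<circ> \<rho>) \<longlonglongrightarrow> X"
    using bounded_imp_convergent_subsequence by blast
  obtain X1 X2 where X: "X = (X1, X2)" by force
  have "(\<lambda>n. norm ((Y \<circ> \<rho>) n)) \<longlonglongrightarrow> norm X" by (intro tendsto_norm \<rho>)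
  hence "norm X = 1" by (simp add: norm_Y LIMSEQ_const_iff)
  let ?e = "\<lambda>n. \<epsilon> (\<rho> n)" and ?Y1 = "\<lambda>n. fst (Y (\<rho> n))" and ?Y2 = "\<lambda>n. snd (Y (\<rho> n))"
  have lim: "?Y1 \<longlonglongrightarrow> X1" "?Y2 \<longlonglongrightarrow> X2" "?e \<longlonglongrightarrow> 0"
    using tendsto_fst[OF \<rho>(2)] tendsto_snd[OF \<rho>(2)] LIMSEQ_subseq_LIMSEQ[OF \<epsilon> \<rho>(1)] by (simp_all add: X o_def)
  have e0: "?e n \<noteq> 0" for n using pos[of "\<rho> n"] by simp
  have "k (\<rho> n) = (mat 1, mat 1) + \<epsilon> (\<rho> n) *\<^sub>R Y (\<rho> n)" for n
    using e0[of n] by (simp add: Y_def)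
  hence kY: "k (\<rho> n) = (mat 1 + ?e n *\<^sub>R ?Y1 n, mat 1 + ?e n *\<^sub>R ?Y2 n)" for n
    by (simp add: prod_eq_iff)
  have stab: "(mat 1 + ?e n *\<^sub>R ?Y1 n, mat 1 + ?e n *\<^sub>R ?Y2 n) \<in> stabilizer h" for n
    using k(1)[of "\<rho> n"] by (simp flip: kY)
  have "trace X1 = 0"
    using stab by (intro trace_limit_zero_2[OF _ e0 lim(3,1)]) (simp add: stabilizer_def G_def)
  moreover have "trace X2 = 0"
    using stab by (intro trace_limit_zero_3[OF _ e0 lim(3,2)]) (simp add: stabilizer_def G_def)
  moreover have "polar h x (x v* X1) y y + polar h x x y (y v* X2) = 0" for x y
    using stab by (intro invariance_limit[OF assms(1) _ e0 lim(3,1,2)]) (simp add: stabilizer_def del: act.simps)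
  ultimately have "X1 = 0" "X2 = 0"
    using no_infinitesimal_stabilizer[OF assms] by blast+
  thus False using \<open>norm X = 1\<close> by (simp add: X)
qed

text \<open>If all these sets were bounded, the orbit would be closed by properness, and the
  stabilizer, lying in one of them, would be bounded and hence finite.\<close>

lemma unbounded_elements_if_not_stable:
  assumes "h \<in> V" "\<not> stable h"
  obtains C where "\<not> bounded (bounded_elements h C)"
proof (rule ccontr)
  assume "\<not> thesis"
  hence bdd: "bounded (bounded_elements h C)" for C using that by blast
  have "bounded (stabilizer h)"
    using stabilizer_subset_bounded_elements[of h] bdd bounded_subset by blast
  hence "stable h"
    unfolding stable_def using closedin_orbit[OF assms(1) bdd] finite_stabilizer[OF assms(1)] by blast
  thus False using assms(2) by contradiction
qed

theorem theorem7p2: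
  fixes h :: form
  assumes "h \<in> V" and "h \<noteq> (\<lambda>_. 0)" and "strictly_semi_stable h"
  shows "(\<exists>f \<in> orbit h.
            f \<in> linear_combinations (M_plus (0, 0) (-1, 0, 1)) \<or>
            f \<in> linear_combinations (M_plus (-1, 1) (-2, 0, 2)) \<or>
            f \<in> linear_combinations (M_plus (-1, 1) (-1, 0, 1)) \<or>
            f \<in> linear_combinations (M_plus (-2, 2) (-1, 0, 1)))
       \<and> (M_plus (0, 0) (-1, 0, 1) \<subseteq> M \<and> M_plus (-1, 1) (-2, 0, 2) \<subseteq> M \<and>
          M_plus (-1, 1) (-1, 0, 1) \<subseteq> M \<and> M_plus (-2, 2) (-1, 0, 1) \<subseteq> M)
       \<and> distinct [M_plus (0, 0) (-1, 0, 1), M_plus (-1, 1) (-2, 0, 2),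
                   M_plus (-1, 1) (-1, 0, 1), M_plus (-2, 2) (-1, 0, 1)]"
proof -
  have "\<not> stable h"
    using assms(3) by (simp add: strictly_semi_stable_def)
  then obtain C where "\<not> bounded (bounded_elements h C)"
    using unbounded_elements_if_not_stable[OF assms(1)] by blast
  then obtain A B and r :: "real^2" and s :: "real^3"
    where "det A \<noteq> 0" "det B \<noteq> 0" "(\<Sum>i\<in>UNIV. r $ i) = 0" "(\<Sum>k\<in>UNIV. s $ k) = 0" "(r, s) \<noteq> 0"
    "\<And>i j k l. r $ i + r $ j + s $ k + s $ l < 0 \<Longrightarrow> polar h (A $ i) (A $ j) (B $ k) (B $ l) = 0"
    using unbounded_imp_weights[OF assms(1)] by metis
  from weights_imp_normal_form[OF assms(1) this] show ?thesis
    using M_plus_subset_M M_plus_distinct by blast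
qed

end
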